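(* Let $X$ be a locally compact Hausdorff space and let $\mathcal{A}$ be a commutative Banach algebra with non-empty character space and with a bounded approximate identity. Then $C_0(X,\mathcal{A})$ is isomorphic with a $C^{\ast}$-algebra if and only if $\mathcal{A}$ is isomorphic with a $C^{\ast}$-algebra.
   Context: $C_0(X,\mathcal{A})$ is the Banach algebra of all continuous functions $f:X\to\mathcal{A}$ vanishing at infinity, with pointwise operations and norm $\|f\|_{\infty,\mathcal{A}}=\sup_{x\in X}\|f(x)\|_{\mathcal{A}}$. Two Banach algebras are called isomorphic if there is a bijective algebra homomorphism between them that is a homeomorphism. The character space $\Delta(\mathcal{A})$ is the set of nonzero multiplicative linear functionals on $\mathcal{A}$ with the Gelfand topology. *)

theory Defs
  imports "HOL-Analysis.Analysis" "HOL-Algebra.Module"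
begin

definition complex_ring :: "complex ring" where
  "complex_ring = \<lparr>carrier = UNIV, mult = (*), one = 1, zero = 0, add = (+)\<rparr>"

lemma cring_complex_ring: "cring complex_ring"
proof (rule cringI)
  show "abelian_group complex_ring"
  proof (rule abelian_groupI)
    fix x :: complex
    show "\<exists>y\<in>carrier complex_ring. y \<oplus>\<^bsub>complex_ring\<^esub> x = \<zero>\<^bsub>complex_ring\<^esub>"
      by (rule bexI[of _ "- x"]) (auto simp: complex_ring_def)
  qed (auto simp: complex_ring_def)
  show "comm_monoid complex_ring"
    by unfold_locales (auto simp: complex_ring_def)
qed (auto simp: complex_ring_def algebra_simps)

text \<open>
  Complex normed algebras with an explicit carrier.  The record inherits the field \<open>one\<close> of
  HOL-Algebra's \<open>module\<close> record; algebras here need not be unital, and that field is never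
  constrained nor used.
\<close>

record 'a normed_alg = "(complex, 'a) module" +
  nrm :: "'a \<Rightarrow> real"

text \<open>
  The locale \<open>Metric_space\<close> requires nonnegativity and symmetry of the distance on the whole
  type, hence the default value off the carrier.
\<close>

definition norm_dist :: "'a normed_alg \<Rightarrow> 'a \<Rightarrow> 'a \<Rightarrow> real" where
  "norm_dist A x y =
    (if x \<in> carrier A \<and> y \<in> carrier A then nrm A (x \<ominus>\<^bsub>A\<^esub> y) else 0)"

definition norm_topology :: "'a normed_alg \<Rightarrow> 'a topology" where
  "norm_topology A = Metric_space.mtopology (carrier A) (norm_dist A)"

locale banach_algebra = module complex_ring A for A :: "'a normed_alg" (structure) +
  assumes mult_closed: "\<lbrakk>x \<in> carrier A; y \<in> carrier A\<rbrakk> \<Longrightarrow> x \<otimes> y \<in> carrier A"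
    and mult_assoc:
      "\<lbrakk>x \<in> carrier A; y \<in> carrier A; z \<in> carrier A\<rbrakk> \<Longrightarrow> (x \<otimes> y) \<otimes> z = x \<otimes> (y \<otimes> z)"
    and mult_distr_left:
      "\<lbrakk>x \<in> carrier A; y \<in> carrier A; z \<in> carrier A\<rbrakk> \<Longrightarrow> (x \<oplus> y) \<otimes> z = x \<otimes> z \<oplus> y \<otimes> z"
    and mult_distr_right:
      "\<lbrakk>x \<in> carrier A; y \<in> carrier A; z \<in> carrier A\<rbrakk> \<Longrightarrow> z \<otimes> (x \<oplus> y) = z \<otimes> x \<oplus> z \<otimes> y"
    and smult_mult_left:
      "\<lbrakk>x \<in> carrier A; y \<in> carrier A\<rbrakk> \<Longrightarrow> (c \<odot> x) \<otimes> y = c \<odot> (x \<otimes> y)"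
    and smult_mult_right:
      "\<lbrakk>x \<in> carrier A; y \<in> carrier A\<rbrakk> \<Longrightarrow> x \<otimes> (c \<odot> y) = c \<odot> (x \<otimes> y)"
    and nrm_nonneg: "x \<in> carrier A \<Longrightarrow> 0 \<le> nrm A x"
    and nrm_eq_zero_iff: "x \<in> carrier A \<Longrightarrow> nrm A x = 0 \<longleftrightarrow> x = \<zero>"
    and nrm_triangle:
      "\<lbrakk>x \<in> carrier A; y \<in> carrier A\<rbrakk> \<Longrightarrow> nrm A (x \<oplus> y) \<le> nrm A x + nrm A y"
    and nrm_smult: "x \<in> carrier A \<Longrightarrow> nrm A (c \<odot> x) = cmod c * nrm A x"
    and nrm_mult:
      "\<lbrakk>x \<in> carrier A; y \<in> carrier A\<rbrakk> \<Longrightarrow> nrm A (x \<otimes> y) \<le> nrm A x * nrm A y"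
    and complete: "Metric_space.mcomplete (carrier A) (norm_dist A)"

locale comm_banach_algebra = banach_algebra +
  assumes mult_commute: "\<lbrakk>x \<in> carrier A; y \<in> carrier A\<rbrakk> \<Longrightarrow> x \<otimes> y = y \<otimes> x"

locale cstar_algebra = banach_algebra +
  fixes star :: "'a \<Rightarrow> 'a"
  assumes star_closed: "x \<in> carrier A \<Longrightarrow> star x \<in> carrier A"
    and star_star: "x \<in> carrier A \<Longrightarrow> star (star x) = x"
    and star_add: "\<lbrakk>x \<in> carrier A; y \<in> carrier A\<rbrakk> \<Longrightarrow> star (x \<oplus> y) = star x \<oplus> star y"
    and star_smult: "x \<in> carrier A \<Longrightarrow> star (c \<odot> x) = cnj c \<odot> star x"
    and star_mult: "\<lbrakk>x \<in> carrier A; y \<in> carrier A\<rbrakk> \<Longrightarrow> star (x \<otimes> y) = star y \<otimes> star x"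
    and cstar_identity: "x \<in> carrier A \<Longrightarrow> nrm A (star x \<otimes> x) = (nrm A x)\<^sup>2"

text \<open>
  The Gelfand topology is the topology of pointwise convergence on \<open>A\<close>.  Characters, as points
  of the product space, are functions extensional on the carrier.
\<close>

definition characters :: "'a normed_alg \<Rightarrow> ('a \<Rightarrow> complex) set" where
  "characters A = {\<phi> \<in> extensional (carrier A).
     (\<forall>x\<in>carrier A. \<forall>y\<in>carrier A. \<phi> (x \<oplus>\<^bsub>A\<^esub> y) = \<phi> x + \<phi> y) \<and>
     (\<forall>c. \<forall>x\<in>carrier A. \<phi> (c \<odot>\<^bsub>A\<^esub> x) = c * \<phi> x) \<and>
     (\<forall>x\<in>carrier A. \<forall>y\<in>carrier A. \<phi> (x \<otimes>\<^bsub>A\<^esub> y) = \<phi> x * \<phi> y) \<and>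
     (\<exists>x\<in>carrier A. \<phi> x \<noteq> 0)}"

definition character_space :: "'a normed_alg \<Rightarrow> ('a \<Rightarrow> complex) topology" where
  "character_space A =
    subtopology (product_topology (\<lambda>_. euclidean) (carrier A)) (characters A)"

lemma topspace_character_space: "topspace (character_space A) = characters A"
  by (auto simp: character_space_def characters_def PiE_def)

text \<open>A net is rendered as a family indexed by a type, together with a proper filter on that type.\<close>

definition bounded_approximate_identity ::
  "'a normed_alg \<Rightarrow> ('i \<Rightarrow> 'a) \<Rightarrow> 'i filter \<Rightarrow> bool" where
  "bounded_approximate_identity A e F \<longleftrightarrow>
     F \<noteq> bot \<and> range e \<subseteq> carrier A \<and> (\<exists>C. \<forall>i. nrm A (e i) \<le> C) \<and>
     (\<forall>a\<in>carrier A. limitin (norm_topology A) (\<lambda>i. e i \<otimes>\<^bsub>A\<^esub> a) a F \<and>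
                    limitin (norm_topology A) (\<lambda>i. a \<otimes>\<^bsub>A\<^esub> e i) a F)"

definition vanishes_at_infinity :: "'x topology \<Rightarrow> 'a normed_alg \<Rightarrow> ('x \<Rightarrow> 'a) \<Rightarrow> bool" where
  "vanishes_at_infinity X A f \<longleftrightarrow>
     (\<forall>\<epsilon>>0. \<exists>K. compactin X K \<and> (\<forall>x\<in>topspace X - K. nrm A (f x) < \<epsilon>))"

text \<open>
  Functions on \<open>X\<close> are extensional on \<open>topspace X\<close>, so that equality is equality on \<open>X\<close>.
  The supremum norm is meaningful for nonempty \<open>X\<close> only.
\<close>

definition C0 :: "'x topology \<Rightarrow> 'a normed_alg \<Rightarrow> ('x \<Rightarrow> 'a) normed_alg" where
  "C0 X A =
    \<lparr>carrier = {f \<in> extensional (topspace X).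
                 continuous_map X (norm_topology A) f \<and> vanishes_at_infinity X A f},
     mult = (\<lambda>f g. \<lambda>x\<in>topspace X. f x \<otimes>\<^bsub>A\<^esub> g x),
     one = undefined,
     zero = (\<lambda>x\<in>topspace X. \<zero>\<^bsub>A\<^esub>),
     add = (\<lambda>f g. \<lambda>x\<in>topspace X. f x \<oplus>\<^bsub>A\<^esub> g x),
     smult = (\<lambda>c f. \<lambda>x\<in>topspace X. c \<odot>\<^bsub>A\<^esub> f x),
     nrm = (\<lambda>f. SUP x\<in>topspace X. nrm A (f x))\<rparr>"

definition algebra_isomorphism :: "'a normed_alg \<Rightarrow> 'b normed_alg \<Rightarrow> ('a \<Rightarrow> 'b) \<Rightarrow> bool" where
  "algebra_isomorphism A B f \<longleftrightarrow>
     bij_betw f (carrier A) (carrier B) \<and>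
     (\<forall>x\<in>carrier A. \<forall>y\<in>carrier A. f (x \<oplus>\<^bsub>A\<^esub> y) = f x \<oplus>\<^bsub>B\<^esub> f y) \<and>
     (\<forall>c. \<forall>x\<in>carrier A. f (c \<odot>\<^bsub>A\<^esub> x) = c \<odot>\<^bsub>B\<^esub> f x) \<and>
     (\<forall>x\<in>carrier A. \<forall>y\<in>carrier A. f (x \<otimes>\<^bsub>A\<^esub> y) = f x \<otimes>\<^bsub>B\<^esub> f y) \<and>
     homeomorphic_map (norm_topology A) (norm_topology B) f"

definition isomorphic_algebras :: "'a normed_alg \<Rightarrow> 'b normed_alg \<Rightarrow> bool" where
  "isomorphic_algebras A B \<longleftrightarrow> (\<exists>f. algebra_isomorphism A B f)"

text \<open>
  The C*-algebra is sought over the element type of \<open>A\<close>.  This is no restriction: by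
  \<open>isomorphic_to_cstar_algebraI\<close> below, a C*-algebra over any type will do.
\<close>

definition isomorphic_to_cstar_algebra :: "'a normed_alg \<Rightarrow> bool" where
  "isomorphic_to_cstar_algebra A \<longleftrightarrow>
     (\<exists>(B :: 'a normed_alg) star. cstar_algebra B star \<and> isomorphic_algebras A B)"

context banach_algebra
begin

lemma smult_closed' [simp]: "x \<in> carrier A \<Longrightarrow> c \<odot> x \<in> carrier A"
  using smult_closed by (simp add: complex_ring_def)

lemma smult_minus_one: 
  assumes x: "x \<in> carrier A"
  shows "(-1) \<odot> x = \<ominus> x"
proof -
  have "0 \<odot> x \<oplus> 0 \<odot> x = 0 \<odot> x"
    using smult_l_distr[of 0 0 x] x by (simp add: complex_ring_def)
  then have z: "0 \<odot> x = \<zero>"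
    using x by (metis M.add.r_cancel_one' smult_closed')
  have "(-1) \<odot> x \<oplus> x = 0 \<odot> x"
    using smult_l_distr[of "-1" 1 x] smult_one[of x] x by (simp add: complex_ring_def)
  then show ?thesis
    using z x by (simp add: M.minus_equality)
qed

lemma nrm_minus: "x \<in> carrier A \<Longrightarrow> nrm A (\<ominus> x) = nrm A x"
  using nrm_smult[of x "-1"] by (simp add: smult_minus_one)

lemma norm_metric_space: "Metric_space (carrier A) (norm_dist A)"
proof
  fix x y z
  show "0 \<le> norm_dist A x y"
    by (simp add: norm_dist_def nrm_nonneg)
  show "norm_dist A x y = norm_dist A y x"
    using nrm_minus[of "x \<ominus> y"]
    by (auto simp: norm_dist_def M.minus_eq M.minus_add M.a_comm)
  assume x: "x \<in> carrier A" and y: "y \<in> carrier A"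
  have "x \<ominus> y = \<zero> \<longleftrightarrow> x = y"
    using x y by (metis M.add.inv_closed M.add.inv_equality M.minus_eq M.minus_minus M.r_neg)
  then show "norm_dist A x y = 0 \<longleftrightarrow> x = y"
    using x y by (simp add: norm_dist_def nrm_eq_zero_iff)
  assume z: "z \<in> carrier A"
  have "x \<ominus> z = (x \<ominus> y) \<oplus> (y \<ominus> z)"
    using x y z by (simp add: M.minus_eq M.a_assoc M.r_neg1)
  then show "norm_dist A x z \<le> norm_dist A x y + norm_dist A y z"
    using x y z nrm_triangle[of "x \<ominus> y" "y \<ominus> z"] by (simp add: norm_dist_def)
qed

end

lemma isomorphic_to_cstar_algebraI:
  fixes A :: "'a normed_alg" and B :: "'b normed_alg"
  assumes A: "banach_algebra A" and B: "cstar_algebra B star" and AB: "isomorphic_algebras A B"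
  shows "isomorphic_to_cstar_algebra A"
proof -
  interpret A: banach_algebra A by (rule A)
  interpret B: cstar_algebra B star by (rule B)
  obtain f where f: "algebra_isomorphism A B f"
    using AB by (auto simp: isomorphic_algebras_def)
  have bij: "bij_betw f (carrier A) (carrier B)"
    and f_add: "\<And>x y. \<lbrakk>x \<in> carrier A; y \<in> carrier A\<rbrakk> \<Longrightarrow> f (x \<oplus>\<^bsub>A\<^esub> y) = f x \<oplus>\<^bsub>B\<^esub> f y"
    and f_smult: "\<And>c x. x \<in> carrier A \<Longrightarrow> f (c \<odot>\<^bsub>A\<^esub> x) = c \<odot>\<^bsub>B\<^esub> f x"
    and f_mult: "\<And>x y. \<lbrakk>x \<in> carrier A; y \<in> carrier A\<rbrakk> \<Longrightarrow> f (x \<otimes>\<^bsub>A\<^esub> y) = f x \<otimes>\<^bsub>B\<^esub> f y"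
    and f_homeo: "homeomorphic_map (norm_topology A) (norm_topology B) f"
    using f by (auto simp: algebra_isomorphism_def)
  define g where "g = inv_into (carrier A) f"
  have f_closed: "f x \<in> carrier B" if "x \<in> carrier A" for x
    using bij that by (auto simp: bij_betw_def)
  have g_closed: "g y \<in> carrier A" if "y \<in> carrier B" for y
    using bij that unfolding g_def by (metis bij_betw_def inv_into_into)
  have fg: "f (g y) = y" if "y \<in> carrier B" for y
    using bij that unfolding g_def by (metis bij_betw_inv_into_right)
  have gf: "g (f x) = x" if "x \<in> carrier A" for x
    using bij that unfolding g_def by (metis bij_betw_inv_into_left)
  have f_eqI: "x = y" if "f x = f y" "x \<in> carrier A" "y \<in> carrier A" for x y
    using that gf by metis
  have f_zero: "f \<zero>\<^bsub>A\<^esub> = \<zero>\<^bsub>B\<^esub>"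
    using f_add[of "\<zero>\<^bsub>A\<^esub>" "\<zero>\<^bsub>A\<^esub>"] f_closed[of "\<zero>\<^bsub>A\<^esub>"] B.M.add.r_cancel_one'[of "f \<zero>\<^bsub>A\<^esub>" "f \<zero>\<^bsub>A\<^esub>"]
    by simp
  have f_diff: "f (x \<ominus>\<^bsub>A\<^esub> y) = f x \<ominus>\<^bsub>B\<^esub> f y" if "x \<in> carrier A" "y \<in> carrier A" for x y
    using that f_add f_smult f_closed
    by (simp add: A.M.minus_eq B.M.minus_eq A.smult_minus_one[symmetric] B.smult_minus_one[symmetric])

  define C where "C = A\<lparr>nrm := \<lambda>x. nrm B (f x)\<rparr>"
  have C_simps [simp]: "carrier C = carrier A" "mult C = mult A" "zero C = zero A" "add C = add A"
      "smult C = smult A" "nrm C = (\<lambda>x. nrm B (f x))"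
    by (simp_all add: C_def)
  have C_minus: "x \<ominus>\<^bsub>C\<^esub> y = x \<ominus>\<^bsub>A\<^esub> y" for x y
    by (simp add: a_minus_def a_inv_def)
  have "abelian_group C"
    using A.M.abelian_group_axioms
    by (simp add: abelian_group_def abelian_group_axioms_def abelian_monoid_def)
  then have "module complex_ring C"
    using A.module_axioms by (simp add: module_def module_axioms_def)
  have dist_C: "norm_dist C x y = norm_dist B (f x) (f y)"
    if "x \<in> carrier A" "y \<in> carrier A" for x y
    using that f_closed f_diff by (simp add: norm_dist_def C_minus)
  interpret MB: Metric_space "carrier B" "norm_dist B"
    by (rule B.norm_metric_space)
  interpret MC: Metric_space "carrier A" "norm_dist C"
  proof
    fix x y z
    have norm_dist_C: "norm_dist C x y =
        (if x \<in> carrier A \<and> y \<in> carrier A then norm_dist B (f x) (f y) else 0)" for x y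
      using dist_C by (auto simp: norm_dist_def)
    show "0 \<le> norm_dist C x y" "norm_dist C x y = norm_dist C y x"
      by (auto simp: norm_dist_C MB.commute)
    assume x: "x \<in> carrier A" and y: "y \<in> carrier A"
    show "norm_dist C x y = 0 \<longleftrightarrow> x = y"
      using x y f_closed f_eqI by (auto simp: dist_C)
    assume z: "z \<in> carrier A"
    show "norm_dist C x z \<le> norm_dist C x y + norm_dist C y z"
      using x y z f_closed MB.triangle by (simp add: dist_C)
  qed
  have C_complete: "MC.mcomplete"
    unfolding MC.mcomplete_def
  proof (intro allI impI)
    fix \<sigma>
    assume \<sigma>: "MC.MCauchy \<sigma>"
    then have \<sigma>_closed: "\<sigma> n \<in> carrier A" for n
      by (auto simp: MC.MCauchy_def)
    have "MB.MCauchy (f \<circ> \<sigma>)"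
      using \<sigma> \<sigma>_closed f_closed by (auto simp: MC.MCauchy_def MB.MCauchy_def dist_C)
    then obtain y where y: "limitin MB.mtopology (f \<circ> \<sigma>) y sequentially"
      using B.complete by (auto simp: MB.mcomplete_def)
    then have "y \<in> carrier B"
      by (simp add: MB.limit_metric_sequentially)
    then have "limitin MC.mtopology \<sigma> (g y) sequentially"
      using y \<sigma>_closed by (simp add: MB.limit_metric_sequentially MC.limit_metric_sequentially
          dist_C g_closed fg f_closed)
    then show "\<exists>x. limitin MC.mtopology \<sigma> x sequentially" ..
  qed
  have "banach_algebra C"
    using \<open>module complex_ring C\<close>
  proof (rule banach_algebra.intro, unfold_locales, unfold C_simps)
    show "MC.mcomplete" by (rule C_complete)
  next
    fix x assume "x \<in> carrier A"
    then show "nrm B (f x) = 0 \<longleftrightarrow> x = \<zero>\<^bsub>A\<^esub>"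
      using B.nrm_eq_zero_iff f_closed f_eqI f_zero A.M.zero_closed by metis
  qed (simp_all add: A.mult_closed A.mult_assoc A.mult_distr_left A.mult_distr_right
      A.smult_mult_left A.smult_mult_right f_closed f_add f_smult f_mult
      B.nrm_nonneg B.nrm_triangle B.nrm_smult B.nrm_mult)
  then have "cstar_algebra C (\<lambda>x. g (star (f x)))"
  proof (rule cstar_algebra.intro, unfold_locales, unfold C_simps)
    fix x y c assume x: "x \<in> carrier A"
    show "g (star (f x)) \<in> carrier A" "g (star (f (g (star (f x))))) = x"
      using x by (simp_all add: f_closed g_closed fg gf B.star_closed B.star_star)
    show "g (star (f (c \<odot>\<^bsub>A\<^esub> x))) = cnj c \<odot>\<^bsub>A\<^esub> g (star (f x))"
      using x by (intro f_eqI) (simp_all add: f_closed g_closed fg f_smult B.star_closed B.star_smult)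
    show "nrm B (f (g (star (f x)) \<otimes>\<^bsub>A\<^esub> x)) = (nrm B (f x))\<^sup>2"
      using x by (simp add: f_closed g_closed fg f_mult B.star_closed B.cstar_identity)
    assume y: "y \<in> carrier A"
    show "g (star (f (x \<oplus>\<^bsub>A\<^esub> y))) = g (star (f x)) \<oplus>\<^bsub>A\<^esub> g (star (f y))"
      using x y by (intro f_eqI) (simp_all add: f_closed g_closed fg f_add B.star_closed B.star_add)
    show "g (star (f (x \<otimes>\<^bsub>A\<^esub> y))) = g (star (f y)) \<otimes>\<^bsub>A\<^esub> g (star (f x))"
      using x y by (intro f_eqI)
        (simp_all add: f_closed g_closed fg f_mult A.mult_closed B.mult_closed B.star_closed B.star_mult)
  qed
  moreover have "algebra_isomorphism A C id"
  proof -
    interpret M12: Metric_space12 "carrier B" "norm_dist B" "carrier A" "norm_dist C" ..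
    have "homeomorphic_map MB.mtopology MC.mtopology g"
    proof (rule M12.isometry_imp_homeomorphic_map)
      show "g ` carrier B = carrier A"
        using f_closed g_closed gf by force
    qed (simp add: dist_C g_closed fg)
    then have gf_homeo: "homeomorphic_map (norm_topology A) (norm_topology C) (g \<circ> f)"
      using homeomorphic_map_compose[OF f_homeo] by (simp add: norm_topology_def)
    have "topspace (norm_topology A) = carrier A"
      using Metric_space.topspace_mtopology[OF A.norm_metric_space] by (simp add: norm_topology_def)
    then have "homeomorphic_map (norm_topology A) (norm_topology C) id"
      by (intro homeomorphic_map_eq[OF gf_homeo]) (simp add: gf)
    then show ?thesis
      by (simp add: algebra_isomorphism_def)
  qed
  ultimately show ?thesis
    unfolding isomorphic_to_cstar_algebra_def isomorphic_algebras_def by blast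
qed

end

theory Submission
  imports Defs
begin

text \<open>
  A pointwise involution makes \<open>C0 X B\<close> a C*-algebra whenever \<open>B\<close> is one. Conversely, let
  \<open>C0 X A\<close> be isomorphic with a C*-algebra \<open>D\<close>, which is then commutative. Evaluation at a point
  gives a bounded homomorphism from \<open>D\<close> onto \<open>A\<close>, and a compactly supported bump function
  provides bounded lifts, so \<open>A\<close> carries an equivalent quotient norm. The kernel is self-adjoint
  and the quotient norm satisfies the C*-identity because every \<open>j\<close> in the kernel has an
  approximate unit in the kernel, \<open>u = s h\<^sup>2 (1 + s h\<^sup>2)\<^sup>-\<^sup>1\<close> with \<open>h = j\<^sup>* j\<close>. Its
  properties follow from \<open>\<parallel>x\<parallel> \<le> \<parallel>x + s h\<^sup>2 x\<parallel>\<close>, which replaces the Gelfand representation and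
  the functional calculus.
\<close>

section \<open>Complex normed spaces with explicit carrier\<close>

text \<open>The obstacle is ideal theory: a closed ideal of a commutative C*-algebra must be shown
  to be self-adjoint, with a quotient norm satisfying the C*-identity. Both facts need elements u of
  the ideal for which multiplication by 1 - u is a contraction. The usual candidate is built from
  the inverse of 1 + s h, whose contractivity rests on the positivity of h = j* j, a spectral fact.
  The price is a fourth power in the estimate of j - u j. Commutativity of D makes u commute with
  every element, so that the involution turns j - u j into j* - u j* and the powers of 1 - u can be
  collected. The bump functions make surjectivity of the evaluation quantitative, so the equivalence
  of the quotient norm with the given one comes with explicit constants.\<close>

locale normed_module = module complex_ring A for A :: "'a normed_alg" (structure) +
  assumes nrm_nonneg: "x \<in> carrier A \<Longrightarrow> 0 \<le> nrm A x"
    and nrm_eq_zero_iff: "x \<in> carrier A \<Longrightarrow> nrm A x = 0 \<longleftrightarrow> x = \<zero>"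
    and nrm_triangle:
      "\<lbrakk>x \<in> carrier A; y \<in> carrier A\<rbrakk> \<Longrightarrow> nrm A (x \<oplus> y) \<le> nrm A x + nrm A y"
    and nrm_smult: "x \<in> carrier A \<Longrightarrow> nrm A (c \<odot> x) = cmod c * nrm A x"
begin

lemma scale_closed [simp]: "x \<in> carrier A \<Longrightarrow> c \<odot> x \<in> carrier A"
  using smult_closed by (simp add: complex_ring_def)

lemma scale_add_left: "x \<in> carrier A \<Longrightarrow> (a + b) \<odot> x = a \<odot> x \<oplus> b \<odot> x"
  using smult_l_distr[of a b x] by (simp add: complex_ring_def)

lemma scale_add_right:
  "\<lbrakk>x \<in> carrier A; y \<in> carrier A\<rbrakk> \<Longrightarrow> a \<odot> (x \<oplus> y) = a \<odot> x \<oplus> a \<odot> y"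
  using smult_r_distr[of a x y] by (simp add: complex_ring_def)

lemma scale_scale: "x \<in> carrier A \<Longrightarrow> a \<odot> (b \<odot> x) = (a * b) \<odot> x"
  using smult_assoc1[of a b x] by (simp add: complex_ring_def)

lemma scale_one [simp]: "x \<in> carrier A \<Longrightarrow> 1 \<odot> x = x"
  using smult_one[of x] by (simp add: complex_ring_def)

lemma scale_zero_left [simp]: "x \<in> carrier A \<Longrightarrow> 0 \<odot> x = \<zero>"
  using smult_l_null[of x] by (simp add: complex_ring_def)

lemma scale_zero_right [simp]: "a \<odot> \<zero> = \<zero>"
  using smult_r_null[of a] by (simp add: complex_ring_def)

lemma scale_minus_one: "x \<in> carrier A \<Longrightarrow> (-1) \<odot> x = \<ominus> x"
  using scale_add_left[of x "-1" 1] by (simp add: M.minus_equality)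

lemma scale_minus_left: "x \<in> carrier A \<Longrightarrow> (- a) \<odot> x = \<ominus> (a \<odot> x)"
  using scale_scale[of x "-1" a] by (simp add: scale_minus_one)

lemma scale_minus_right: "x \<in> carrier A \<Longrightarrow> a \<odot> (\<ominus> x) = \<ominus> (a \<odot> x)"
  using scale_scale[of x a "-1"] scale_minus_left[of x a] by (simp add: scale_minus_one)

lemma scale_diff_right:
  "\<lbrakk>x \<in> carrier A; y \<in> carrier A\<rbrakk> \<Longrightarrow> a \<odot> (x \<ominus> y) = a \<odot> x \<ominus> a \<odot> y"
  by (simp add: M.minus_eq scale_add_right scale_minus_right)

text \<open>Sets up the \<open>algebra\<close> method for the additive group alone. Products and
  scalar multiples are opaque to it, which is why later proofs record their membership in the
  carrier before calling it.\<close>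

lemmas group_simprules [algebra add: abelian_group "zero A" "add A" "a_inv A" "a_minus A"] =
  M.a_closed M.zero_closed M.a_inv_closed M.minus_closed M.a_assoc M.a_comm M.a_lcomm
  M.l_zero M.r_zero M.minus_eq M.l_neg M.r_neg M.r_neg1 M.r_neg2 M.minus_add M.minus_minus

lemma diff_eq_zero_iff:
  assumes "x \<in> carrier A" "y \<in> carrier A"
  shows "x \<ominus> y = \<zero> \<longleftrightarrow> x = y"
  using assms by (metis M.add.inv_closed M.add.inv_equality M.minus_eq M.minus_minus M.r_neg)

lemma diff_add_cancel: "\<lbrakk>x \<in> carrier A; y \<in> carrier A\<rbrakk> \<Longrightarrow> x \<ominus> y \<oplus> y = x"
  by algebra

lemma diff_zero [simp]: "x \<in> carrier A \<Longrightarrow> x \<ominus> \<zero> = x"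
  using diff_add_cancel[of x \<zero>] by simp

lemma nrm_zero [simp]: "nrm A \<zero> = 0"
  by (simp add: nrm_eq_zero_iff)

lemma nrm_uminus: "x \<in> carrier A \<Longrightarrow> nrm A (\<ominus> x) = nrm A x"
  using nrm_smult[of x "-1"] by (simp add: scale_minus_one)

lemma nrm_diff_commute:
  assumes "x \<in> carrier A" "y \<in> carrier A"
  shows "nrm A (x \<ominus> y) = nrm A (y \<ominus> x)"
  using nrm_uminus[of "x \<ominus> y"] assms by (simp add: M.minus_eq M.minus_add M.a_comm)

lemma nrm_diff_triangle:
  assumes "x \<in> carrier A" "y \<in> carrier A" "z \<in> carrier A"
  shows "nrm A (x \<ominus> z) \<le> nrm A (x \<ominus> y) + nrm A (y \<ominus> z)"
proof -
  have "x \<ominus> z = (x \<ominus> y) \<oplus> (y \<ominus> z)"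
    using assms by algebra
  then show ?thesis
    using nrm_triangle[of "x \<ominus> y" "y \<ominus> z"] assms by simp
qed

lemma nrm_diff_le:
  assumes "x \<in> carrier A" "y \<in> carrier A"
  shows "nrm A (x \<ominus> y) \<le> nrm A x + nrm A y"
  using nrm_triangle[of x "\<ominus> y"] assms by (simp add: M.minus_eq nrm_uminus)

lemma nrm_le_add_diff:
  assumes "x \<in> carrier A" "y \<in> carrier A"
  shows "nrm A x \<le> nrm A y + nrm A (x \<ominus> y)"
  using nrm_triangle[of "x \<ominus> y" y] assms by (simp add: diff_add_cancel)

sublocale metric: Metric_space "carrier A" "norm_dist A"
proof
  fix x y z
  show "0 \<le> norm_dist A x y" and "norm_dist A x y = norm_dist A y x"
    by (simp_all add: norm_dist_def nrm_nonneg nrm_diff_commute)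
  assume x: "x \<in> carrier A" and y: "y \<in> carrier A"
  show "norm_dist A x y = 0 \<longleftrightarrow> x = y"
    using x y by (simp add: norm_dist_def nrm_eq_zero_iff diff_eq_zero_iff)
  assume "z \<in> carrier A"
  then show "norm_dist A x z \<le> norm_dist A x y + norm_dist A y z"
    using x y by (simp add: norm_dist_def nrm_diff_triangle)
qed

lemma topspace_norm_topology [simp]: "topspace (norm_topology A) = carrier A"
  by (simp add: norm_topology_def)

text \<open>\<open>norm_dist\<close> is 0 by default off the carrier, so balls can be traded for
  norms of differences only once \<open>f\<close> is known to map into the carrier; hence the two
  separate conditions.\<close>

lemma continuous_map_norm_topology_iff:
  "continuous_map X (norm_topology A) f \<longleftrightarrow>
     f \<in> topspace X \<rightarrow> carrier A \<and>
     (\<forall>x\<in>topspace X. \<forall>\<epsilon>>0. \<exists>U. openin X U \<and> x \<in> U \<and> (\<forall>y\<in>U. nrm A (f y \<ominus> f x) < \<epsilon>))"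
    (is "_ \<longleftrightarrow> ?f \<and> ?cont")
proof -
  have "continuous_map X (norm_topology A) f \<longleftrightarrow> ?f \<and> continuous_map X (norm_topology A) f"
    by (metis continuous_map_funspace topspace_norm_topology)
  also have "\<dots> \<longleftrightarrow> ?f \<and> ?cont"
  proof (rule conj_cong[OF refl])
    assume f: ?f
    have *: "(\<forall>y\<in>U. f y \<in> metric.mball (f x) \<epsilon>) \<longleftrightarrow> (\<forall>y\<in>U. nrm A (f y \<ominus> f x) < \<epsilon>)"
      if "openin X U" "x \<in> U" for U x \<epsilon>
    proof -
      have "f y \<in> carrier A" if "y \<in> U" for y
        using f that openin_subset[OF \<open>openin X U\<close>] by auto
      then show ?thesis
        using \<open>x \<in> U\<close> by (auto simp: norm_dist_def nrm_diff_commute)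
    qed
    have "(\<exists>U. openin X U \<and> x \<in> U \<and> (\<forall>y\<in>U. f y \<in> metric.mball (f x) \<epsilon>)) \<longleftrightarrow>
        (\<exists>U. openin X U \<and> x \<in> U \<and> (\<forall>y\<in>U. nrm A (f y \<ominus> f x) < \<epsilon>))" for x \<epsilon>
      by (rule ex_cong1, rule conj_cong[OF refl], rule conj_cong[OF refl], rule *)
    then show "continuous_map X (norm_topology A) f \<longleftrightarrow> ?cont"
      by (simp only: norm_topology_def metric.continuous_map_to_metric)
  qed
  finally show ?thesis .
qed

lemma limitin_norm_topology_sequentially:
  assumes "\<And>n. \<sigma> n \<in> carrier A"
  shows "limitin (norm_topology A) \<sigma> l sequentially \<longleftrightarrow>
    l \<in> carrier A \<and> (\<forall>\<epsilon>>0. \<exists>N. \<forall>n\<ge>N. nrm A (\<sigma> n \<ominus> l) < \<epsilon>)"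
  using assms by (auto simp: norm_topology_def metric.limit_metric_sequentially norm_dist_def)

text \<open>The form in which completeness is later verified for \<open>C0 X A\<close> and for the
  quotient norm.\<close>

lemma mcomplete_iff:
  "metric.mcomplete \<longleftrightarrow>
     (\<forall>\<sigma> :: nat \<Rightarrow> 'a. (\<forall>n. \<sigma> n \<in> carrier A) \<and> (\<forall>\<epsilon>>0. \<exists>N. \<forall>m\<ge>N. \<forall>n\<ge>N. nrm A (\<sigma> m \<ominus> \<sigma> n) < \<epsilon>) \<longrightarrow>
        (\<exists>l\<in>carrier A. \<forall>\<epsilon>>0. \<exists>N. \<forall>n\<ge>N. nrm A (\<sigma> n \<ominus> l) < \<epsilon>))"
proof -
  have "(metric.MCauchy \<sigma> \<longrightarrow> (\<exists>l. limitin metric.mtopology \<sigma> l sequentially)) \<longleftrightarrow>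
      (\<forall>n. \<sigma> n \<in> carrier A) \<and> (\<forall>\<epsilon>>0. \<exists>N. \<forall>m\<ge>N. \<forall>n\<ge>N. nrm A (\<sigma> m \<ominus> \<sigma> n) < \<epsilon>) \<longrightarrow>
        (\<exists>l\<in>carrier A. \<forall>\<epsilon>>0. \<exists>N. \<forall>n\<ge>N. nrm A (\<sigma> n \<ominus> l) < \<epsilon>)" for \<sigma>
  proof (cases "\<forall>n. \<sigma> n \<in> carrier A")
    case True
    then have range: "range \<sigma> \<subseteq> carrier A" and dist: "norm_dist A (\<sigma> m) (\<sigma> n) = nrm A (\<sigma> m \<ominus> \<sigma> n)" for m n
      by (auto simp: norm_dist_def)
    have "metric.MCauchy \<sigma> \<longleftrightarrow>
        (\<forall>\<epsilon>>0. \<exists>N. \<forall>m\<ge>N. \<forall>n\<ge>N. nrm A (\<sigma> m \<ominus> \<sigma> n) < \<epsilon>)"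
      unfolding metric.MCauchy_def dist using range by (simp only: simp_thms) (meson order_refl)
    moreover have "(\<exists>l. limitin metric.mtopology \<sigma> l sequentially) \<longleftrightarrow>
        (\<exists>l\<in>carrier A. \<forall>\<epsilon>>0. \<exists>N. \<forall>n\<ge>N. nrm A (\<sigma> n \<ominus> l) < \<epsilon>)"
      using limitin_norm_topology_sequentially[of \<sigma>] True
      by (simp only: norm_topology_def Bex_def)
    ultimately show ?thesis
      using True by argo
  next
    case False
    then have "\<not> metric.MCauchy \<sigma>"
      unfolding metric.MCauchy_def by blast
    then show ?thesis
      using False by argo
  qed
  then show ?thesis
    by (simp only: metric.mcomplete_def)
qed

end

text \<open>The part of a Banach algebra without product and completeness is split off so that its
  theory applies to \<open>C0 X A\<close> and to the quotient norm before either is known to be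
  complete.\<close>

sublocale banach_algebra \<subseteq> normed: normed_module A
  by unfold_locales (simp_all add: nrm_nonneg nrm_eq_zero_iff nrm_triangle nrm_smult)

section \<open>Bounded linear maps and algebra isomorphisms\<close>

locale linear_map = A: normed_module A + B: normed_module B
  for A :: "'a normed_alg" and B :: "'b normed_alg" +
  fixes f :: "'a \<Rightarrow> 'b"
  assumes closed: "x \<in> carrier A \<Longrightarrow> f x \<in> carrier B"
    and add: "\<lbrakk>x \<in> carrier A; y \<in> carrier A\<rbrakk> \<Longrightarrow> f (x \<oplus>\<^bsub>A\<^esub> y) = f x \<oplus>\<^bsub>B\<^esub> f y"
    and scale: "x \<in> carrier A \<Longrightarrow> f (c \<odot>\<^bsub>A\<^esub> x) = c \<odot>\<^bsub>B\<^esub> f x"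
begin

lemma zero: "f \<zero>\<^bsub>A\<^esub> = \<zero>\<^bsub>B\<^esub>"
proof -
  have "f (0 \<odot>\<^bsub>A\<^esub> \<zero>\<^bsub>A\<^esub>) = 0 \<odot>\<^bsub>B\<^esub> f \<zero>\<^bsub>A\<^esub>"
    by (rule scale) simp
  then show ?thesis
    by (simp add: closed)
qed

lemma diff:
  assumes "x \<in> carrier A" "y \<in> carrier A"
  shows "f (x \<ominus>\<^bsub>A\<^esub> y) = f x \<ominus>\<^bsub>B\<^esub> f y"
proof -
  have "f (x \<oplus>\<^bsub>A\<^esub> (-1) \<odot>\<^bsub>A\<^esub> y) = f x \<oplus>\<^bsub>B\<^esub> (-1) \<odot>\<^bsub>B\<^esub> f y"
    using assms by (simp add: add scale)
  then show ?thesis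
    using assms by (simp add: A.M.minus_eq B.M.minus_eq A.scale_minus_one B.scale_minus_one closed)
qed

lemma continuous_map_if_bounded:
  assumes bound: "\<And>x. x \<in> carrier A \<Longrightarrow> nrm B (f x) \<le> C * nrm A x"
  shows "continuous_map (norm_topology A) (norm_topology B) f"
  unfolding B.continuous_map_norm_topology_iff
proof (intro conjI ballI allI impI)
  show "f \<in> topspace (norm_topology A) \<rightarrow> carrier B"
    using closed by simp
  fix x :: 'a and \<epsilon> :: real
  assume x: "x \<in> topspace (norm_topology A)" and \<epsilon>: "\<epsilon> > 0"
  \<comment> \<open>\<open>C\<close> carries no sign condition; |C| + 1 is positive and dominates
    it.\<close>
  let ?U = "A.metric.mball x (\<epsilon> / (\<bar>C\<bar> + 1))"
  have "nrm B (f y \<ominus>\<^bsub>B\<^esub> f x) < \<epsilon>" if y: "y \<in> ?U" for y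
  proof -
    have y': "y \<in> carrier A" and d: "nrm A (y \<ominus>\<^bsub>A\<^esub> x) < \<epsilon> / (\<bar>C\<bar> + 1)"
      using x y by (auto simp: norm_dist_def A.nrm_diff_commute)
    have "nrm B (f y \<ominus>\<^bsub>B\<^esub> f x) = nrm B (f (y \<ominus>\<^bsub>A\<^esub> x))"
      using x y' by (simp add: diff)
    also have "\<dots> \<le> C * nrm A (y \<ominus>\<^bsub>A\<^esub> x)"
      using x y' bound by simp
    also have "\<dots> \<le> (\<bar>C\<bar> + 1) * nrm A (y \<ominus>\<^bsub>A\<^esub> x)"
      using x y' by (intro mult_right_mono A.nrm_nonneg) auto
    also have "\<dots> < \<epsilon>"
      using d by (simp add: pos_less_divide_eq mult.commute add_nonneg_pos)
    finally show ?thesis .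
  qed
  then show "\<exists>U. openin (norm_topology A) U \<and> x \<in> U \<and> (\<forall>y\<in>U. nrm B (f y \<ominus>\<^bsub>B\<^esub> f x) < \<epsilon>)"
    using x \<epsilon> by (intro exI[of _ ?U]) (auto simp: norm_topology_def)
qed

text \<open>Continuity at zero gives a ball of some radius r that is mapped into the unit ball;
  scaling a nonzero x to norm r / 2 yields the constant 2 / r.\<close>

lemma bounded_if_continuous_map:
  assumes "continuous_map (norm_topology A) (norm_topology B) f"
  obtains C where "C > 0" "\<And>x. x \<in> carrier A \<Longrightarrow> nrm B (f x) \<le> C * nrm A x"
proof -
  obtain U where U: "openin (norm_topology A) U" "\<zero>\<^bsub>A\<^esub> \<in> U"
    and fU: "\<And>y. y \<in> U \<Longrightarrow> nrm B (f y \<ominus>\<^bsub>B\<^esub> f \<zero>\<^bsub>A\<^esub>) < 1"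
    using conjunct2[OF assms[unfolded B.continuous_map_norm_topology_iff],
        rule_format, of "\<zero>\<^bsub>A\<^esub>" 1] by auto
  obtain r where r: "r > 0" and rU: "A.metric.mball \<zero>\<^bsub>A\<^esub> r \<subseteq> U"
    using U by (auto simp: norm_topology_def A.metric.openin_mtopology)
  have "nrm B (f x) \<le> 2 / r * nrm A x" if x: "x \<in> carrier A" for x
  proof (cases "x = \<zero>\<^bsub>A\<^esub>")
    case False
    then have pos: "nrm A x > 0"
      using x A.nrm_nonneg A.nrm_eq_zero_iff by (metis less_eq_real_def)
    define c where "c = r / (2 * nrm A x)"
    have c: "c > 0"
      using r pos by (simp add: c_def)
    let ?y = "complex_of_real c \<odot>\<^bsub>A\<^esub> x"
    have "nrm A ?y = c * nrm A x"
      using x c by (simp add: A.nrm_smult)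
    also have "\<dots> < r"
      using r pos by (simp add: c_def)
    finally have "nrm A ?y < r" .
    moreover have "nrm A (\<zero>\<^bsub>A\<^esub> \<ominus>\<^bsub>A\<^esub> ?y) = nrm A ?y"
      using x by (simp add: A.M.minus_eq A.nrm_uminus)
    ultimately have "?y \<in> A.metric.mball \<zero>\<^bsub>A\<^esub> r"
      using x by (simp add: norm_dist_def)
    then have "nrm B (f ?y \<ominus>\<^bsub>B\<^esub> f \<zero>\<^bsub>A\<^esub>) < 1"
      using rU fU by blast
    then have "c * nrm B (f x) < 1"
      using x c by (simp add: zero scale closed B.nrm_smult)
    then show ?thesis
      using c r pos by (simp add: c_def field_simps)
  qed (simp add: zero)
  then show ?thesis
    using that[of "2 / r"] r by simp
qed

end

text \<open>Norm bounds in both directions replace the homeomorphism condition, since a bounded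
  linear map is continuous.\<close>

lemma algebra_isomorphismI:
  fixes A :: "'a normed_alg" and B :: "'b normed_alg"
  assumes f: "linear_map A B f" and g: "linear_map B A g"
    and gf: "\<And>x. x \<in> carrier A \<Longrightarrow> g (f x) = x" and fg: "\<And>y. y \<in> carrier B \<Longrightarrow> f (g y) = y"
    and mult: "\<And>x y. \<lbrakk>x \<in> carrier A; y \<in> carrier A\<rbrakk> \<Longrightarrow> f (x \<otimes>\<^bsub>A\<^esub> y) = f x \<otimes>\<^bsub>B\<^esub> f y"
    and f_bound: "\<And>x. x \<in> carrier A \<Longrightarrow> nrm B (f x) \<le> C * nrm A x"
    and g_bound: "\<And>y. y \<in> carrier B \<Longrightarrow> nrm A (g y) \<le> D * nrm B y"
  shows "algebra_isomorphism A B f"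
proof -
  interpret f: linear_map A B f by (rule f)
  interpret g: linear_map B A g by (rule g)
  have "homeomorphic_maps (norm_topology A) (norm_topology B) f g"
    unfolding homeomorphic_maps_def
    using f.continuous_map_if_bounded[OF f_bound] g.continuous_map_if_bounded[OF g_bound] gf fg
    by simp
  moreover have "bij_betw f (carrier A) (carrier B)"
    by (rule bij_betw_byWitness[where f' = g]) (auto simp: gf fg f.closed g.closed)
  ultimately show ?thesis
    by (simp add: algebra_isomorphism_def f.add f.scale mult homeomorphic_maps_map)
qed

text \<open>Continuity of a linear map and of its inverse is turned into positive constants, the
  only form in which the topology of an isomorphism is used afterwards.\<close>

lemma algebra_isomorphismE:
  fixes A :: "'a normed_alg" and B :: "'b normed_alg"
  assumes A: "normed_module A" and B: "normed_module B" and f: "algebra_isomorphism A B f"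
  obtains g C D where "linear_map A B f" "linear_map B A g"
    "\<And>x. x \<in> carrier A \<Longrightarrow> g (f x) = x" "\<And>y. y \<in> carrier B \<Longrightarrow> f (g y) = y"
    "\<And>x y. \<lbrakk>x \<in> carrier A; y \<in> carrier A\<rbrakk> \<Longrightarrow> f (x \<otimes>\<^bsub>A\<^esub> y) = f x \<otimes>\<^bsub>B\<^esub> f y"
    "C > 0" "\<And>x. x \<in> carrier A \<Longrightarrow> nrm B (f x) \<le> C * nrm A x"
    "D > 0" "\<And>y. y \<in> carrier B \<Longrightarrow> nrm A (g y) \<le> D * nrm B y"
proof -
  interpret A: normed_module A by (rule A)
  interpret B: normed_module B by (rule B)
  have f_add: "\<And>x y. \<lbrakk>x \<in> carrier A; y \<in> carrier A\<rbrakk> \<Longrightarrow> f (x \<oplus>\<^bsub>A\<^esub> y) = f x \<oplus>\<^bsub>B\<^esub> f y"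
    and f_scale: "\<And>c x. x \<in> carrier A \<Longrightarrow> f (c \<odot>\<^bsub>A\<^esub> x) = c \<odot>\<^bsub>B\<^esub> f x"
    and f_mult: "\<And>x y. \<lbrakk>x \<in> carrier A; y \<in> carrier A\<rbrakk> \<Longrightarrow> f (x \<otimes>\<^bsub>A\<^esub> y) = f x \<otimes>\<^bsub>B\<^esub> f y"
    and "homeomorphic_map (norm_topology A) (norm_topology B) f"
    using f by (auto simp: algebra_isomorphism_def)
  then obtain g where fg_homeo: "homeomorphic_maps (norm_topology A) (norm_topology B) f g"
    by (auto simp: homeomorphic_map_maps)
  then have f_cont: "continuous_map (norm_topology A) (norm_topology B) f"
    and g_cont: "continuous_map (norm_topology B) (norm_topology A) g"
    and gf: "\<And>x. x \<in> carrier A \<Longrightarrow> g (f x) = x" and fg: "\<And>y. y \<in> carrier B \<Longrightarrow> f (g y) = y"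
    by (auto simp: homeomorphic_maps_def)
  have f_closed: "f x \<in> carrier B" if "x \<in> carrier A" for x
    using f_cont that by (auto simp: B.continuous_map_norm_topology_iff)
  have g_closed: "g y \<in> carrier A" if "y \<in> carrier B" for y
    using g_cont that by (auto simp: A.continuous_map_norm_topology_iff)
  interpret f: linear_map A B f
    by unfold_locales (simp_all add: f_closed f_add f_scale)
  interpret g: linear_map B A g
  proof
    show "g (x \<oplus>\<^bsub>B\<^esub> y) = g x \<oplus>\<^bsub>A\<^esub> g y" if "x \<in> carrier B" "y \<in> carrier B" for x y
      using gf[of "g x \<oplus>\<^bsub>A\<^esub> g y"] that by (simp add: g_closed f_add fg)
    show "g (c \<odot>\<^bsub>B\<^esub> x) = c \<odot>\<^bsub>A\<^esub> g x" if "x \<in> carrier B" for x c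
      using gf[of "c \<odot>\<^bsub>A\<^esub> g x"] that by (simp add: g_closed f_scale fg)
  qed (rule g_closed)
  obtain C where C: "C > 0" "\<And>x. x \<in> carrier A \<Longrightarrow> nrm B (f x) \<le> C * nrm A x"
    using f.bounded_if_continuous_map[OF f_cont] by blast
  obtain D where D: "D > 0" "\<And>y. y \<in> carrier B \<Longrightarrow> nrm A (g y) \<le> D * nrm B y"
    using g.bounded_if_continuous_map[OF g_cont] by blast
  show ?thesis
    by (rule that[of g C D]) (use f.linear_map_axioms g.linear_map_axioms gf fg f_mult C D in auto)
qed

section \<open>The Banach algebra of functions vanishing at infinity\<close>

lemma mem_carrier_C0_iff:
  "f \<in> carrier (C0 X A) \<longleftrightarrow> f \<in> extensional (topspace X) \<and>
     continuous_map X (norm_topology A) f \<and> vanishes_at_infinity X A f"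
  by (simp add: C0_def)

lemma C0_simps:
  "f \<oplus>\<^bsub>C0 X A\<^esub> g = (\<lambda>x\<in>topspace X. f x \<oplus>\<^bsub>A\<^esub> g x)"
  "f \<otimes>\<^bsub>C0 X A\<^esub> g = (\<lambda>x\<in>topspace X. f x \<otimes>\<^bsub>A\<^esub> g x)"
  "c \<odot>\<^bsub>C0 X A\<^esub> f = (\<lambda>x\<in>topspace X. c \<odot>\<^bsub>A\<^esub> f x)"
  "\<zero>\<^bsub>C0 X A\<^esub> = (\<lambda>x\<in>topspace X. \<zero>\<^bsub>A\<^esub>)"
  "nrm (C0 X A) f = (SUP x\<in>topspace X. nrm A (f x))"
  by (simp_all add: C0_def)

lemma C0_eqI:
  assumes "f \<in> carrier (C0 X A)" "g \<in> carrier (C0 X A)" "\<And>x. x \<in> topspace X \<Longrightarrow> f x = g x"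
  shows "f = g"
  using assms by (auto simp: mem_carrier_C0_iff intro: extensionalityI)

context normed_module
begin

lemma C0_app_closed: "\<lbrakk>f \<in> carrier (C0 X A); x \<in> topspace X\<rbrakk> \<Longrightarrow> f x \<in> carrier A"
  by (auto simp: mem_carrier_C0_iff continuous_map_norm_topology_iff)

text \<open>Makes the supremum norm meaningful: \<open>f\<close> is small off a compact set, and on
  it the image is compact, hence bounded.\<close>

lemma C0_bdd_above:
  assumes f: "f \<in> carrier (C0 X A)"
  shows "bdd_above ((\<lambda>x. nrm A (f x)) ` topspace X)"
proof -
  obtain K where K: "compactin X K" and out: "\<And>x. x \<in> topspace X - K \<Longrightarrow> nrm A (f x) < 1"
    using f zero_less_one unfolding mem_carrier_C0_iff vanishes_at_infinity_def by metis
  have "compactin metric.mtopology (f ` K)"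
    using f K image_compactin by (fastforce simp: mem_carrier_C0_iff norm_topology_def)
  \<comment> \<open>Inserting zero turns a bound on mutual distances into a bound on norms.\<close>
  then have "metric.mbounded (insert \<zero> (f ` K))"
    using metric.compactin_imp_mbounded metric.mbounded_insert by auto
  then obtain B where B: "\<And>x. x \<in> K \<Longrightarrow> norm_dist A (f x) \<zero> \<le> B"
    unfolding metric.mbounded_alt by blast
  have "nrm A (f x) \<le> max 1 B" if "x \<in> topspace X" for x
  proof (cases "x \<in> K")
    case True
    then show ?thesis
      using B[OF True] C0_app_closed[OF f that] by (simp add: norm_dist_def)
  qed (use out that in force)
  then show ?thesis
    by (rule bdd_aboveI2)
qed

lemma nrm_app_le_nrm_C0:
  "\<lbrakk>f \<in> carrier (C0 X A); x \<in> topspace X\<rbrakk> \<Longrightarrow> nrm A (f x) \<le> nrm (C0 X A) f"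
  unfolding C0_simps(5) by (rule cSUP_upper[OF _ C0_bdd_above])

end

lemma nrm_C0_le:
  assumes "topspace X \<noteq> {}" "\<And>x. x \<in> topspace X \<Longrightarrow> nrm A (f x) \<le> c"
  shows "nrm (C0 X A) f \<le> c"
  using assms by (simp add: C0_simps(5) cSUP_least)

text \<open>One criterion serves sums, multiples, products, involutions and compositions: a function
  whose increments and values are controlled by those of \<open>f\<close> and \<open>g\<close>
  inherits continuity and decay from them. The two algebras may differ, and \<open>c\<close> may
  have any sign.\<close>

lemma C0_memI:
  fixes A :: "'a normed_alg" and B :: "'b normed_alg"
  assumes A: "normed_module A" and B: "normed_module B"
    and f: "f \<in> carrier (C0 X B)" and g: "g \<in> carrier (C0 X B)"
    and ext: "h \<in> extensional (topspace X)"
    and closed: "\<And>x. x \<in> topspace X \<Longrightarrow> h x \<in> carrier A"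
    and lipschitz: "\<And>x y. \<lbrakk>x \<in> topspace X; y \<in> topspace X\<rbrakk> \<Longrightarrow>
      nrm A (h y \<ominus>\<^bsub>A\<^esub> h x) \<le> c * (nrm B (f y \<ominus>\<^bsub>B\<^esub> f x) + nrm B (g y \<ominus>\<^bsub>B\<^esub> g x))"
    and dominated: "\<And>x. x \<in> topspace X \<Longrightarrow> nrm A (h x) \<le> c * (nrm B (f x) + nrm B (g x))"
  shows "h \<in> carrier (C0 X A)"
  unfolding mem_carrier_C0_iff
proof (intro conjI ext)
  interpret A: normed_module A by (rule A)
  interpret B: normed_module B by (rule B)
  \<comment> \<open>The denominator 2|c| + 1 leaves room for two summands and covers c = 0.\<close>
  have small: "c * (s + t) < \<epsilon>"
    if "0 \<le> s" "0 \<le> t" "s < \<epsilon> / (2 * \<bar>c\<bar> + 1)" "t < \<epsilon> / (2 * \<bar>c\<bar> + 1)" for s t \<epsilon> :: real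
  proof -
    have "c * (s + t) \<le> \<bar>c\<bar> * (s + t)"
      using that by (intro mult_right_mono) auto
    also have "\<dots> \<le> \<bar>c\<bar> * (2 * (\<epsilon> / (2 * \<bar>c\<bar> + 1)))"
      using that by (intro mult_left_mono) auto
    also have "\<dots> < \<epsilon>"
    proof -
      have "\<epsilon> / (2 * \<bar>c\<bar> + 1) > 0"
        using that by linarith
      then have "\<epsilon> > 0"
        by (auto simp: zero_less_divide_iff)
      then show ?thesis
        by (simp add: field_simps)
    qed
    finally show ?thesis .
  qed
  have pos: "\<epsilon> / (2 * \<bar>c\<bar> + 1) > 0" if "\<epsilon> > 0" for \<epsilon>
    using that by simp
  show "continuous_map X (norm_topology A) h"
    unfolding A.continuous_map_norm_topology_iff
  proof (intro conjI ballI allI impI)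
    show "h \<in> topspace X \<rightarrow> carrier A"
      using closed by simp
    fix x \<epsilon> assume x: "x \<in> topspace X" and \<epsilon>: "(\<epsilon>::real) > 0"
    obtain U where U: "openin X U" "x \<in> U"
        "\<And>y. y \<in> U \<Longrightarrow> nrm B (f y \<ominus>\<^bsub>B\<^esub> f x) < \<epsilon> / (2 * \<bar>c\<bar> + 1)"
      using f x pos[OF \<epsilon>] unfolding mem_carrier_C0_iff B.continuous_map_norm_topology_iff by metis
    obtain V where V: "openin X V" "x \<in> V"
        "\<And>y. y \<in> V \<Longrightarrow> nrm B (g y \<ominus>\<^bsub>B\<^esub> g x) < \<epsilon> / (2 * \<bar>c\<bar> + 1)"
      using g x pos[OF \<epsilon>] unfolding mem_carrier_C0_iff B.continuous_map_norm_topology_iff by metis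
    show "\<exists>U. openin X U \<and> x \<in> U \<and> (\<forall>y\<in>U. nrm A (h y \<ominus>\<^bsub>A\<^esub> h x) < \<epsilon>)"
    proof (intro exI conjI ballI)
      show "openin X (U \<inter> V)" "x \<in> U \<inter> V"
        using U V by auto
      fix y assume y: "y \<in> U \<inter> V"
      then have y': "y \<in> topspace X"
        using U(1) openin_subset by blast
      have "c * (nrm B (f y \<ominus>\<^bsub>B\<^esub> f x) + nrm B (g y \<ominus>\<^bsub>B\<^esub> g x)) < \<epsilon>"
        using U V y x y' f g by (intro small) (auto simp: B.nrm_nonneg B.C0_app_closed)
      then show "nrm A (h y \<ominus>\<^bsub>A\<^esub> h x) < \<epsilon>"
        using lipschitz[OF x y'] by linarith
    qed
  qed
  show "vanishes_at_infinity X A h"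
    unfolding vanishes_at_infinity_def
  proof (intro allI impI)
    fix \<epsilon> :: real assume \<epsilon>: "\<epsilon> > 0"
    obtain K where K: "compactin X K"
        "\<And>x. x \<in> topspace X - K \<Longrightarrow> nrm B (f x) < \<epsilon> / (2 * \<bar>c\<bar> + 1)"
      using f pos[OF \<epsilon>] unfolding mem_carrier_C0_iff vanishes_at_infinity_def by metis
    obtain L where L: "compactin X L"
        "\<And>x. x \<in> topspace X - L \<Longrightarrow> nrm B (g x) < \<epsilon> / (2 * \<bar>c\<bar> + 1)"
      using g pos[OF \<epsilon>] unfolding mem_carrier_C0_iff vanishes_at_infinity_def by metis
    show "\<exists>K. compactin X K \<and> (\<forall>x\<in>topspace X - K. nrm A (h x) < \<epsilon>)"
    proof (intro exI conjI ballI)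
      show "compactin X (K \<union> L)"
        using K L by (simp add: compactin_Un)
      fix x assume x: "x \<in> topspace X - (K \<union> L)"
      have "c * (nrm B (f x) + nrm B (g x)) < \<epsilon>"
        using K L x f g by (intro small) (auto simp: B.nrm_nonneg B.C0_app_closed)
      then show "nrm A (h x) < \<epsilon>"
        using dominated[of x] x by auto
    qed
  qed
qed

section \<open>Products and the algebra structure of \<open>C0 X A\<close>\<close>

context banach_algebra
begin

lemma mult_zero_left: "x \<in> carrier A \<Longrightarrow> \<zero> \<otimes> x = \<zero>"
  using smult_mult_left[of \<zero> x 0] by (simp add: mult_closed)

lemma mult_zero_right: "x \<in> carrier A \<Longrightarrow> x \<otimes> \<zero> = \<zero>"
  using smult_mult_right[of x \<zero> 0] by (simp add: mult_closed)

lemma mult_uminus_left: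
  "\<lbrakk>x \<in> carrier A; y \<in> carrier A\<rbrakk> \<Longrightarrow> (\<ominus> x) \<otimes> y = \<ominus> (x \<otimes> y)"
  using smult_mult_left[of x y "-1"] by (simp add: normed.scale_minus_one mult_closed)

lemma mult_uminus_right:
  "\<lbrakk>x \<in> carrier A; y \<in> carrier A\<rbrakk> \<Longrightarrow> x \<otimes> (\<ominus> y) = \<ominus> (x \<otimes> y)"
  using smult_mult_right[of x y "-1"] by (simp add: normed.scale_minus_one mult_closed)

lemma mult_diff_distrib_left:
  "\<lbrakk>x \<in> carrier A; y \<in> carrier A; z \<in> carrier A\<rbrakk> \<Longrightarrow> (x \<ominus> y) \<otimes> z = x \<otimes> z \<ominus> y \<otimes> z"
  by (simp add: M.minus_eq mult_distr_left mult_uminus_left)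

lemma mult_diff_distrib_right:
  "\<lbrakk>x \<in> carrier A; y \<in> carrier A; z \<in> carrier A\<rbrakk> \<Longrightarrow> z \<otimes> (x \<ominus> y) = z \<otimes> x \<ominus> z \<otimes> y"
  by (simp add: M.minus_eq mult_distr_right mult_uminus_right)

lemma nrm_mult_diff:
  assumes "x \<in> carrier A" "y \<in> carrier A" "x' \<in> carrier A" "y' \<in> carrier A"
  shows "nrm A (x \<otimes> y \<ominus> x' \<otimes> y') \<le> nrm A x * nrm A (y \<ominus> y') + nrm A (x \<ominus> x') * nrm A y'"
proof -
  have "nrm A (x \<otimes> y \<ominus> x' \<otimes> y') \<le> nrm A (x \<otimes> (y \<ominus> y')) + nrm A ((x \<ominus> x') \<otimes> y')"
    using assms normed.nrm_diff_triangle[of "x \<otimes> y" "x \<otimes> y'" "x' \<otimes> y'"]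
    by (simp add: mult_diff_distrib_left mult_diff_distrib_right mult_closed)
  then show ?thesis
    using assms nrm_mult[of x "y \<ominus> y'"] nrm_mult[of "x \<ominus> x'" y'] by simp
qed

end

locale C0_of_banach_algebra = banach_algebra A for A :: "'a normed_alg" (structure) +
  fixes X :: "'x topology"
  assumes nonempty: "topspace X \<noteq> {}"
begin

lemma C0_zero_closed: "\<zero>\<^bsub>C0 X A\<^esub> \<in> carrier (C0 X A)"
  unfolding mem_carrier_C0_iff
proof (intro conjI)
  show "continuous_map X (norm_topology A) \<zero>\<^bsub>C0 X A\<^esub>"
    by (rule continuous_map_eq[of _ _ "\<lambda>_. \<zero>"]) (auto simp: C0_simps)
  show "vanishes_at_infinity X A \<zero>\<^bsub>C0 X A\<^esub>"
    unfolding vanishes_at_infinity_def by (auto simp: C0_simps intro!: exI[of _ "{}"])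
qed (simp add: C0_simps)

lemma C0_add_closed:
  assumes f: "f \<in> carrier (C0 X A)" and g: "g \<in> carrier (C0 X A)"
  shows "f \<oplus>\<^bsub>C0 X A\<^esub> g \<in> carrier (C0 X A)"
proof (rule C0_memI[where c = 1, OF normed.normed_module_axioms normed.normed_module_axioms f g])
  fix x assume x: "x \<in> topspace X"
  note closed = normed.C0_app_closed[OF f] normed.C0_app_closed[OF g]
  show "(f \<oplus>\<^bsub>C0 X A\<^esub> g) x \<in> carrier A"
    using x closed by (simp add: C0_simps)
  show "nrm A ((f \<oplus>\<^bsub>C0 X A\<^esub> g) x) \<le> 1 * (nrm A (f x) + nrm A (g x))"
    using x closed by (simp add: C0_simps nrm_triangle)
  fix y assume y: "y \<in> topspace X"
  have app: "f x \<in> carrier A" "f y \<in> carrier A" "g x \<in> carrier A" "g y \<in> carrier A"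
    using x y closed by auto
  have "(f y \<oplus> g y) \<ominus> (f x \<oplus> g x) = (f y \<ominus> f x) \<oplus> (g y \<ominus> g x)"
    using app by algebra
  then show "nrm A ((f \<oplus>\<^bsub>C0 X A\<^esub> g) y \<ominus> (f \<oplus>\<^bsub>C0 X A\<^esub> g) x) \<le>
      1 * (nrm A (f y \<ominus> f x) + nrm A (g y \<ominus> g x))"
    using x y app nrm_triangle[of "f y \<ominus> f x" "g y \<ominus> g x"] by (simp add: C0_simps)
qed (simp add: C0_simps)

lemma C0_smult_closed:
  assumes f: "f \<in> carrier (C0 X A)"
  shows "a \<odot>\<^bsub>C0 X A\<^esub> f \<in> carrier (C0 X A)"
\<comment> \<open>The zero function fills the second slot of the criterion.\<close>
proof (rule C0_memI[where c = "cmod a",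
      OF normed.normed_module_axioms normed.normed_module_axioms f C0_zero_closed])
  fix x assume x: "x \<in> topspace X"
  note closed = normed.C0_app_closed[OF f]
  show "(a \<odot>\<^bsub>C0 X A\<^esub> f) x \<in> carrier A"
    using x closed by (simp add: C0_simps)
  show "nrm A ((a \<odot>\<^bsub>C0 X A\<^esub> f) x) \<le> cmod a * (nrm A (f x) + nrm A (\<zero>\<^bsub>C0 X A\<^esub> x))"
    using x closed by (simp add: C0_simps nrm_smult)
  fix y assume y: "y \<in> topspace X"
  then show "nrm A ((a \<odot>\<^bsub>C0 X A\<^esub> f) y \<ominus> (a \<odot>\<^bsub>C0 X A\<^esub> f) x) \<le>
      cmod a * (nrm A (f y \<ominus> f x) + nrm A (\<zero>\<^bsub>C0 X A\<^esub> y \<ominus> \<zero>\<^bsub>C0 X A\<^esub> x))"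
    using x closed by (simp add: C0_simps nrm_smult flip: normed.scale_diff_right)
qed (simp add: C0_simps)

text \<open>Multiplication is Lipschitz only on bounded sets, so the constant is built from the
  finite supremum norms of the factors.\<close>

lemma C0_mult_closed:
  assumes f: "f \<in> carrier (C0 X A)" and g: "g \<in> carrier (C0 X A)"
  shows "f \<otimes>\<^bsub>C0 X A\<^esub> g \<in> carrier (C0 X A)"
proof (rule C0_memI[where c = "nrm (C0 X A) f + nrm (C0 X A) g",
      OF normed.normed_module_axioms normed.normed_module_axioms f g])
  let ?F = "nrm (C0 X A) f" and ?G = "nrm (C0 X A) g"
  fix x assume x: "x \<in> topspace X"
  note closed = normed.C0_app_closed[OF f] normed.C0_app_closed[OF g]
  note le = normed.nrm_app_le_nrm_C0[OF f] normed.nrm_app_le_nrm_C0[OF g]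
  have nonneg: "0 \<le> ?F" "0 \<le> ?G"
    using x le closed nrm_nonneg by (meson order.trans)+
  show "(f \<otimes>\<^bsub>C0 X A\<^esub> g) x \<in> carrier A"
    using x closed by (simp add: C0_simps mult_closed)
  have "nrm A (f x \<otimes> g x) \<le> nrm A (f x) * nrm A (g x)"
    using x closed by (simp add: nrm_mult)
  also have "\<dots> \<le> ?F * nrm A (g x)"
    using x le closed by (simp add: mult_right_mono nrm_nonneg)
  also have "\<dots> \<le> (?F + ?G) * (nrm A (f x) + nrm A (g x))"
    using x closed nonneg by (intro mult_mono) (auto simp: nrm_nonneg)
  finally show "nrm A ((f \<otimes>\<^bsub>C0 X A\<^esub> g) x) \<le> (?F + ?G) * (nrm A (f x) + nrm A (g x))"
    using x by (simp add: C0_simps)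
  fix y assume y: "y \<in> topspace X"
  have "nrm A (f y \<otimes> g y \<ominus> f x \<otimes> g x) \<le>
      nrm A (f y) * nrm A (g y \<ominus> g x) + nrm A (f y \<ominus> f x) * nrm A (g x)"
    using x y closed by (simp add: nrm_mult_diff)
  also have "\<dots> \<le> (?F + ?G) * nrm A (g y \<ominus> g x) + nrm A (f y \<ominus> f x) * (?F + ?G)"
    using x y le closed nonneg
    by (intro add_mono mult_mono) (auto simp: nrm_nonneg intro: order.trans[OF le(1)] order.trans[OF le(2)])
  finally show "nrm A ((f \<otimes>\<^bsub>C0 X A\<^esub> g) y \<ominus> (f \<otimes>\<^bsub>C0 X A\<^esub> g) x) \<le>
      (?F + ?G) * (nrm A (f y \<ominus> f x) + nrm A (g y \<ominus> g x))"
    using x y by (simp add: C0_simps algebra_simps)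
qed (simp add: C0_simps)

sublocale C0: normed_module "C0 X A"
proof (intro normed_module.intro moduleI cring_complex_ring abelian_groupI normed_module_axioms.intro)
  note [simp] = C0_add_closed C0_smult_closed C0_zero_closed normed.C0_app_closed
  show "\<exists>g\<in>carrier (C0 X A). g \<oplus>\<^bsub>C0 X A\<^esub> f = \<zero>\<^bsub>C0 X A\<^esub>" if f: "f \<in> carrier (C0 X A)" for f
  proof (rule bexI)
    show "(-1) \<odot>\<^bsub>C0 X A\<^esub> f \<oplus>\<^bsub>C0 X A\<^esub> f = \<zero>\<^bsub>C0 X A\<^esub>"
      using f by (intro C0_eqI[of _ X A]) (simp_all, simp add: C0_simps normed.scale_minus_one M.l_neg)
  qed (use f in simp)
  show "f \<oplus>\<^bsub>C0 X A\<^esub> g \<oplus>\<^bsub>C0 X A\<^esub> h = f \<oplus>\<^bsub>C0 X A\<^esub> (g \<oplus>\<^bsub>C0 X A\<^esub> h)"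
    if "f \<in> carrier (C0 X A)" "g \<in> carrier (C0 X A)" "h \<in> carrier (C0 X A)" for f g h
    using that by (intro C0_eqI[of _ X A]) (simp_all, simp add: C0_simps M.a_assoc)
  show "f \<oplus>\<^bsub>C0 X A\<^esub> g = g \<oplus>\<^bsub>C0 X A\<^esub> f"
    if "f \<in> carrier (C0 X A)" "g \<in> carrier (C0 X A)" for f g
    using that by (intro C0_eqI[of _ X A]) (simp_all, simp add: C0_simps M.a_comm)
  show "\<zero>\<^bsub>C0 X A\<^esub> \<oplus>\<^bsub>C0 X A\<^esub> f = f" if "f \<in> carrier (C0 X A)" for f
    using that by (intro C0_eqI[of _ X A]) (simp_all, simp add: C0_simps)
  show "a \<odot>\<^bsub>C0 X A\<^esub> (f \<oplus>\<^bsub>C0 X A\<^esub> g) = a \<odot>\<^bsub>C0 X A\<^esub> f \<oplus>\<^bsub>C0 X A\<^esub> a \<odot>\<^bsub>C0 X A\<^esub> g"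
    if "f \<in> carrier (C0 X A)" "g \<in> carrier (C0 X A)" for a f g
    using that by (intro C0_eqI[of _ X A]) (simp_all, simp add: C0_simps normed.scale_add_right)
  fix f assume f: "f \<in> carrier (C0 X A)"
  show "(a \<oplus>\<^bsub>complex_ring\<^esub> b) \<odot>\<^bsub>C0 X A\<^esub> f = a \<odot>\<^bsub>C0 X A\<^esub> f \<oplus>\<^bsub>C0 X A\<^esub> b \<odot>\<^bsub>C0 X A\<^esub> f" for a b
    using f by (intro C0_eqI[of _ X A])
      (simp_all, simp add: C0_simps complex_ring_def normed.scale_add_left)
  show "(a \<otimes>\<^bsub>complex_ring\<^esub> b) \<odot>\<^bsub>C0 X A\<^esub> f = a \<odot>\<^bsub>C0 X A\<^esub> (b \<odot>\<^bsub>C0 X A\<^esub> f)" for a b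
    using f by (intro C0_eqI[of _ X A])
      (simp_all, simp add: C0_simps complex_ring_def normed.scale_scale)
  show "\<one>\<^bsub>complex_ring\<^esub> \<odot>\<^bsub>C0 X A\<^esub> f = f"
    using f by (intro C0_eqI[of _ X A]) (simp_all, simp add: C0_simps complex_ring_def)
  have nrm_app_nonneg: "0 \<le> nrm A (f x)" if "x \<in> topspace X" for x
    using f that by (simp add: nrm_nonneg)
  obtain x0 where x0: "x0 \<in> topspace X"
    using nonempty by blast
  show nonneg: "0 \<le> nrm (C0 X A) f"
    using normed.nrm_app_le_nrm_C0[OF f x0] nrm_app_nonneg[OF x0] by linarith
  show "nrm (C0 X A) f = 0 \<longleftrightarrow> f = \<zero>\<^bsub>C0 X A\<^esub>"
  proof
    assume 0: "nrm (C0 X A) f = 0"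
    show "f = \<zero>\<^bsub>C0 X A\<^esub>"
    proof (intro C0_eqI[OF f C0_zero_closed])
      fix x assume x: "x \<in> topspace X"
      then have "nrm A (f x) = 0"
        using normed.nrm_app_le_nrm_C0[OF f x] nrm_app_nonneg[OF x] 0 by linarith
      then show "f x = \<zero>\<^bsub>C0 X A\<^esub> x"
        using f x nrm_eq_zero_iff by (simp add: C0_simps)
    qed
  qed (use nonempty in \<open>simp add: C0_simps\<close>)
  show "nrm (C0 X A) (c \<odot>\<^bsub>C0 X A\<^esub> f) = cmod c * nrm (C0 X A) f" for c
  proof (rule antisym)
    have le: "nrm (C0 X A) (c \<odot>\<^bsub>C0 X A\<^esub> h) \<le> cmod c * nrm (C0 X A) h"
      if h: "h \<in> carrier (C0 X A)" for c h
      using h by (intro nrm_C0_le nonempty)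
        (auto simp: C0_simps(3) nrm_smult normed.nrm_app_le_nrm_C0 mult_left_mono)
    show "nrm (C0 X A) (c \<odot>\<^bsub>C0 X A\<^esub> f) \<le> cmod c * nrm (C0 X A) f"
      by (rule le[OF f])
    show "cmod c * nrm (C0 X A) f \<le> nrm (C0 X A) (c \<odot>\<^bsub>C0 X A\<^esub> f)"
    proof (cases "c = 0")
      case True
      have "0 \<le> nrm A ((c \<odot>\<^bsub>C0 X A\<^esub> f) x0)"
        using x0 f by (simp add: C0_simps nrm_nonneg)
      then show ?thesis
        using True normed.nrm_app_le_nrm_C0[OF C0_smult_closed[OF f] x0, of c] by simp
    next
      case False
      \<comment> \<open>For nonzero \<open>c\<close> the reverse inequality is \<open>le\<close>
        itself, applied to the inverse scalar.\<close>
      have "inverse c \<odot>\<^bsub>C0 X A\<^esub> (c \<odot>\<^bsub>C0 X A\<^esub> f) = f"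
        using f False
        by (intro C0_eqI[of _ X A]) (simp_all, simp add: C0_simps normed.scale_scale)
      then have "nrm (C0 X A) f \<le> cmod (inverse c) * nrm (C0 X A) (c \<odot>\<^bsub>C0 X A\<^esub> f)"
        using le[of "c \<odot>\<^bsub>C0 X A\<^esub> f" "inverse c"] f by simp
      then show ?thesis
        using False by (simp add: norm_divide field_simps)
    qed
  qed
  fix g assume g: "g \<in> carrier (C0 X A)"
  show "nrm (C0 X A) (f \<oplus>\<^bsub>C0 X A\<^esub> g) \<le> nrm (C0 X A) f + nrm (C0 X A) g"
  proof (rule nrm_C0_le[OF nonempty])
    fix x assume x: "x \<in> topspace X"
    have "nrm A (f x \<oplus> g x) \<le> nrm A (f x) + nrm A (g x)"
      using f g x by (simp add: nrm_triangle)
    also have "\<dots> \<le> nrm (C0 X A) f + nrm (C0 X A) g"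
      using f g x by (intro add_mono normed.nrm_app_le_nrm_C0)
    finally show "nrm A ((f \<oplus>\<^bsub>C0 X A\<^esub> g) x) \<le> nrm (C0 X A) f + nrm (C0 X A) g"
      using x by (simp add: C0_simps)
  qed
qed (simp_all add: C0_add_closed C0_smult_closed C0_zero_closed)

lemma C0_diff_app:
  assumes "f \<in> carrier (C0 X A)" "g \<in> carrier (C0 X A)" "x \<in> topspace X"
  shows "(f \<ominus>\<^bsub>C0 X A\<^esub> g) x = f x \<ominus> g x"
  using assms by (simp add: C0.M.minus_eq C0_simps(1,3) M.minus_eq normed.C0_app_closed
      flip: C0.scale_minus_one normed.scale_minus_one)

text \<open>A norm-Cauchy sequence is uniformly Cauchy, so its uniform limit is continuous; the
  limit decays because it stays within \<epsilon> / 2 of a single late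
  \<open>\<sigma> n\<close>.\<close>

lemma C0_complete: "C0.metric.mcomplete"
  unfolding C0.mcomplete_iff
proof (intro allI impI, elim conjE)
  fix \<sigma> :: "nat \<Rightarrow> 'x \<Rightarrow> 'a"
  assume \<sigma>: "\<forall>n. \<sigma> n \<in> carrier (C0 X A)"
    and cauchy: "\<forall>\<epsilon>>0. \<exists>N. \<forall>m\<ge>N. \<forall>n\<ge>N. nrm (C0 X A) (\<sigma> m \<ominus>\<^bsub>C0 X A\<^esub> \<sigma> n) < \<epsilon>"
  have \<sigma>_closed: "\<sigma> n \<in> carrier (C0 X A)" for n
    using \<sigma> by blast
  note \<sigma>_app [simp] = normed.C0_app_closed[OF \<sigma>_closed]
  have \<sigma>_cont: "continuous_map X normed.metric.mtopology (\<sigma> n)" for n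
    using \<sigma>_closed[of n] by (simp add: mem_carrier_C0_iff norm_topology_def)
  have dist_le: "norm_dist A (\<sigma> m x) (\<sigma> n x) \<le> nrm (C0 X A) (\<sigma> m \<ominus>\<^bsub>C0 X A\<^esub> \<sigma> n)"
    if "x \<in> topspace X" for m n x
    using normed.nrm_app_le_nrm_C0[OF C0.M.minus_closed[OF \<sigma>_closed \<sigma>_closed] that, of m n] that
    by (simp add: norm_dist_def C0_diff_app[OF \<sigma>_closed \<sigma>_closed])
  obtain g0 where g0_cont: "continuous_map X normed.metric.mtopology g0"
    and lim: "\<And>\<epsilon>. 0 < \<epsilon> \<Longrightarrow>
      \<forall>\<^sub>F n in sequentially. \<forall>x\<in>topspace X. norm_dist A (\<sigma> n x) (g0 x) < \<epsilon>"
  proof (rule normed.metric.continuous_map_uniformly_Cauchy_limit)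
    show "\<exists>N. \<forall>m n x. N \<le> m \<longrightarrow> N \<le> n \<longrightarrow> x \<in> topspace X \<longrightarrow> norm_dist A (\<sigma> m x) (\<sigma> n x) < \<epsilon>"
      if "\<epsilon> > 0" for \<epsilon>
      using cauchy that dist_le by (meson order.strict_trans1)
  qed (use complete \<sigma>_cont in auto)
  \<comment> \<open>\<open>g0\<close> is unrestricted off \<open>topspace X\<close>; elements of
    \<open>C0 X A\<close> must be extensional.\<close>
  define g where "g = restrict g0 (topspace X)"
  have g0_app: "g0 x \<in> carrier A" if "x \<in> topspace X" for x
    using g0_cont that by (auto simp: continuous_map_def)
  have approx: "\<exists>N. \<forall>n\<ge>N. \<forall>x\<in>topspace X. nrm A (\<sigma> n x \<ominus> g x) < \<epsilon>" if "\<epsilon> > 0" for \<epsilon>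
    using lim[OF that] by (simp add: eventually_sequentially norm_dist_def g_def g0_app)
  have g_closed: "g \<in> carrier (C0 X A)"
    unfolding mem_carrier_C0_iff
  proof (intro conjI)
    show "continuous_map X (norm_topology A) g"
      using g0_cont by (auto simp: g_def norm_topology_def intro: continuous_map_eq)
    show "vanishes_at_infinity X A g"
      unfolding vanishes_at_infinity_def
    proof (intro allI impI)
      fix \<epsilon> :: real assume "\<epsilon> > 0"
      then have half: "\<epsilon> / 2 > 0" by simp
      obtain n where n: "\<And>x. x \<in> topspace X \<Longrightarrow> nrm A (\<sigma> n x \<ominus> g x) < \<epsilon> / 2"
        using approx[OF half] by blast
      obtain K where "compactin X K" and K: "\<And>x. x \<in> topspace X - K \<Longrightarrow> nrm A (\<sigma> n x) < \<epsilon> / 2"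
        using \<sigma>_closed[of n] half unfolding mem_carrier_C0_iff vanishes_at_infinity_def by metis
      moreover have "nrm A (g x) < \<epsilon>" if "x \<in> topspace X - K" for x
        using normed.nrm_le_add_diff[of "g x" "\<sigma> n x"] normed.nrm_diff_commute[of "g x" "\<sigma> n x"]
          n[of x] K[of x] that g0_app by (auto simp: g_def)
      ultimately show "\<exists>K. compactin X K \<and> (\<forall>x\<in>topspace X - K. nrm A (g x) < \<epsilon>)"
        by blast
    qed
  qed (simp add: g_def)
  show "\<exists>l\<in>carrier (C0 X A). \<forall>\<epsilon>>0. \<exists>N. \<forall>n\<ge>N. nrm (C0 X A) (\<sigma> n \<ominus>\<^bsub>C0 X A\<^esub> l) < \<epsilon>"
  proof (intro bexI[OF _ g_closed] allI impI)
    fix \<epsilon> :: real assume "\<epsilon> > 0"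
    then obtain N where N: "\<And>n x. \<lbrakk>n \<ge> N; x \<in> topspace X\<rbrakk> \<Longrightarrow> nrm A (\<sigma> n x \<ominus> g x) < \<epsilon> / 2"
      using approx[of "\<epsilon> / 2"] by auto
    \<comment> \<open>Strict pointwise bounds become weak ones in the supremum, hence the detour
      through \<epsilon> / 2.\<close>
    have "nrm (C0 X A) (\<sigma> n \<ominus>\<^bsub>C0 X A\<^esub> g) \<le> \<epsilon> / 2" if "n \<ge> N" for n
      using N[OF that] by (intro nrm_C0_le nonempty)
        (simp add: C0_diff_app[OF \<sigma>_closed g_closed] less_imp_le)
    then show "\<exists>N. \<forall>n\<ge>N. nrm (C0 X A) (\<sigma> n \<ominus>\<^bsub>C0 X A\<^esub> g) < \<epsilon>"
      using \<open>\<epsilon> > 0\<close> by (intro exI[of _ N]) fastforce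
  qed
qed

lemma C0_nrm_mult:
  assumes f: "f \<in> carrier (C0 X A)" and g: "g \<in> carrier (C0 X A)"
  shows "nrm (C0 X A) (f \<otimes>\<^bsub>C0 X A\<^esub> g) \<le> nrm (C0 X A) f * nrm (C0 X A) g"
proof (rule nrm_C0_le[OF nonempty])
  fix x assume x: "x \<in> topspace X"
  have "nrm A (f x \<otimes> g x) \<le> nrm A (f x) * nrm A (g x)"
    using f g x by (simp add: nrm_mult normed.C0_app_closed)
  also have "\<dots> \<le> nrm (C0 X A) f * nrm (C0 X A) g"
    using f g x by (intro mult_mono normed.nrm_app_le_nrm_C0 C0.nrm_nonneg nrm_nonneg normed.C0_app_closed)
  finally show "nrm A ((f \<otimes>\<^bsub>C0 X A\<^esub> g) x) \<le> nrm (C0 X A) f * nrm (C0 X A) g"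
    using x by (simp add: C0_simps)
qed

lemma banach_algebra_C0: "banach_algebra (C0 X A)"
proof (intro banach_algebra.intro banach_algebra_axioms.intro)
  note [simp] = C0_add_closed C0_smult_closed C0_mult_closed normed.C0_app_closed
  show "module complex_ring (C0 X A)"
    by (rule C0.module_axioms)
  fix f g h c assume f: "f \<in> carrier (C0 X A)" and g: "g \<in> carrier (C0 X A)"
  show "(c \<odot>\<^bsub>C0 X A\<^esub> f) \<otimes>\<^bsub>C0 X A\<^esub> g = c \<odot>\<^bsub>C0 X A\<^esub> (f \<otimes>\<^bsub>C0 X A\<^esub> g)"
    using f g by (intro C0_eqI[of _ X A]) (simp_all, simp add: C0_simps smult_mult_left)
  show "f \<otimes>\<^bsub>C0 X A\<^esub> (c \<odot>\<^bsub>C0 X A\<^esub> g) = c \<odot>\<^bsub>C0 X A\<^esub> (f \<otimes>\<^bsub>C0 X A\<^esub> g)"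
    using f g by (intro C0_eqI[of _ X A]) (simp_all, simp add: C0_simps smult_mult_right)
  assume h: "h \<in> carrier (C0 X A)"
  show "f \<otimes>\<^bsub>C0 X A\<^esub> g \<otimes>\<^bsub>C0 X A\<^esub> h = f \<otimes>\<^bsub>C0 X A\<^esub> (g \<otimes>\<^bsub>C0 X A\<^esub> h)"
    using f g h by (intro C0_eqI[of _ X A]) (simp_all, simp add: C0_simps mult_assoc)
  show "(f \<oplus>\<^bsub>C0 X A\<^esub> g) \<otimes>\<^bsub>C0 X A\<^esub> h = f \<otimes>\<^bsub>C0 X A\<^esub> h \<oplus>\<^bsub>C0 X A\<^esub> g \<otimes>\<^bsub>C0 X A\<^esub> h"
    using f g h by (intro C0_eqI[of _ X A]) (simp_all, simp add: C0_simps mult_distr_left)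
  show "h \<otimes>\<^bsub>C0 X A\<^esub> (f \<oplus>\<^bsub>C0 X A\<^esub> g) = h \<otimes>\<^bsub>C0 X A\<^esub> f \<oplus>\<^bsub>C0 X A\<^esub> h \<otimes>\<^bsub>C0 X A\<^esub> g"
    using f g h by (intro C0_eqI[of _ X A]) (simp_all, simp add: C0_simps mult_distr_right)
qed (simp_all add: C0_mult_closed C0_nrm_mult C0_complete C0.nrm_nonneg C0.nrm_eq_zero_iff
    C0.nrm_triangle C0.nrm_smult)

end

section \<open>Functoriality and bump functions\<close>

context cstar_algebra
begin

lemma star_uminus: "x \<in> carrier A \<Longrightarrow> star (\<ominus> x) = \<ominus> star x"
  using star_smult[of x "-1"] by (simp add: normed.scale_minus_one star_closed)

lemma star_diff:
  "\<lbrakk>x \<in> carrier A; y \<in> carrier A\<rbrakk> \<Longrightarrow> star (x \<ominus> y) = star x \<ominus> star y"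
  by (simp add: M.minus_eq star_add star_uminus)

text \<open>The C*-identity and submultiplicativity give ||y||^2 <= ||y*|| ||y||, so ||y|| <=
  ||y*||; this is used for \<open>x\<close> and for \<open>star x\<close>.\<close>

lemma nrm_star:
  assumes x: "x \<in> carrier A"
  shows "nrm A (star x) = nrm A x"
proof -
  have le: "nrm A y \<le> nrm A (star y)" if y: "y \<in> carrier A" for y
  proof (cases "nrm A y = 0")
    case True
    then show ?thesis
      using y nrm_nonneg[of "star y"] by (simp add: star_closed)
  next
    case False
    have "nrm A y * nrm A y \<le> nrm A (star y) * nrm A y"
      using y cstar_identity[of y] nrm_mult[of "star y" y] by (simp add: star_closed power2_eq_square)
    then show ?thesis
      using False nrm_nonneg[OF y] by simp
  qed
  show ?thesis
    using le[OF x] le[OF star_closed[OF x]] x by (simp add: star_star)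
qed

lemma cstar_algebra_C0:
  assumes nonempty: "topspace X \<noteq> {}"
  shows "cstar_algebra (C0 X A) (\<lambda>f. \<lambda>x\<in>topspace X. star (f x))"
proof -
  interpret X: C0_of_banach_algebra A X
    by unfold_locales (rule nonempty)
  let ?S = "\<lambda>f. \<lambda>x\<in>topspace X. star (f x)"
  have S_closed: "?S f \<in> carrier (C0 X A)" if f: "f \<in> carrier (C0 X A)" for f
  proof (rule C0_memI[where c = 1,
        OF normed.normed_module_axioms normed.normed_module_axioms f X.C0_zero_closed])
    fix x assume x: "x \<in> topspace X"
    note closed = normed.C0_app_closed[OF f]
    show "?S f x \<in> carrier A" "nrm A (?S f x) \<le> 1 * (nrm A (f x) + nrm A (\<zero>\<^bsub>C0 X A\<^esub> x))"
      using x closed by (simp_all add: star_closed nrm_star C0_simps)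
    fix y assume y: "y \<in> topspace X"
    have "nrm A (star (f y) \<ominus> star (f x)) = nrm A (f y \<ominus> f x)"
      using x y closed nrm_star[of "f y \<ominus> f x"] by (simp add: star_diff)
    then show "nrm A (?S f y \<ominus> ?S f x) \<le>
        1 * (nrm A (f y \<ominus> f x) + nrm A (\<zero>\<^bsub>C0 X A\<^esub> y \<ominus> \<zero>\<^bsub>C0 X A\<^esub> x))"
      using x y by (simp add: C0_simps)
  qed simp
  note [simp] = S_closed X.C0_add_closed X.C0_smult_closed X.C0_mult_closed normed.C0_app_closed
  show ?thesis
  proof (intro cstar_algebra.intro cstar_algebra_axioms.intro X.banach_algebra_C0)
    fix f c assume f: "f \<in> carrier (C0 X A)"
    show "?S f \<in> carrier (C0 X A)"
      using f by (rule S_closed)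
    show "?S (?S f) = f"
      using f by (intro C0_eqI[of _ X A]) (simp_all only: S_closed, simp add: star_star)
    show "?S (c \<odot>\<^bsub>C0 X A\<^esub> f) = cnj c \<odot>\<^bsub>C0 X A\<^esub> ?S f"
      using f by (intro C0_eqI[of _ X A] S_closed X.C0_smult_closed) (simp_all add: C0_simps star_smult)
    show "nrm (C0 X A) (?S f \<otimes>\<^bsub>C0 X A\<^esub> f) = (nrm (C0 X A) f)\<^sup>2"
    proof (rule antisym)
      have sq: "nrm A ((?S f \<otimes>\<^bsub>C0 X A\<^esub> f) x) = (nrm A (f x))\<^sup>2" if "x \<in> topspace X" for x
        using f that by (simp add: C0_simps cstar_identity)
      show "nrm (C0 X A) (?S f \<otimes>\<^bsub>C0 X A\<^esub> f) \<le> (nrm (C0 X A) f)\<^sup>2"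
        using f by (intro nrm_C0_le nonempty)
          (simp add: sq power_mono normed.nrm_app_le_nrm_C0 nrm_nonneg)
      have Sf: "?S f \<otimes>\<^bsub>C0 X A\<^esub> f \<in> carrier (C0 X A)"
        using f by (intro X.C0_mult_closed S_closed)
      \<comment> \<open>The square is moved to the other side as a root, so that the pointwise
        identity bounds the supremum of the unsquared norms.\<close>
      have "nrm (C0 X A) f \<le> sqrt (nrm (C0 X A) (?S f \<otimes>\<^bsub>C0 X A\<^esub> f))"
      proof (rule nrm_C0_le[OF nonempty])
        fix x assume x: "x \<in> topspace X"
        show "nrm A (f x) \<le> sqrt (nrm (C0 X A) (?S f \<otimes>\<^bsub>C0 X A\<^esub> f))"
          using normed.nrm_app_le_nrm_C0[OF Sf x] unfolding sq[OF x] by (rule real_le_rsqrt)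
      qed
      then have "(nrm (C0 X A) f)\<^sup>2 \<le> (sqrt (nrm (C0 X A) (?S f \<otimes>\<^bsub>C0 X A\<^esub> f)))\<^sup>2"
        by (rule power_mono) (rule X.C0.nrm_nonneg[OF f])
      then show "(nrm (C0 X A) f)\<^sup>2 \<le> nrm (C0 X A) (?S f \<otimes>\<^bsub>C0 X A\<^esub> f)"
        using X.C0.nrm_nonneg[OF Sf] by simp
    qed
    fix g assume g: "g \<in> carrier (C0 X A)"
    show "?S (f \<oplus>\<^bsub>C0 X A\<^esub> g) = ?S f \<oplus>\<^bsub>C0 X A\<^esub> ?S g"
      using f g by (intro C0_eqI[of _ X A] S_closed X.C0_add_closed) (simp_all add: C0_simps star_add)
    show "?S (f \<otimes>\<^bsub>C0 X A\<^esub> g) = ?S g \<otimes>\<^bsub>C0 X A\<^esub> ?S f"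
      using f g by (intro C0_eqI[of _ X A] S_closed X.C0_mult_closed) (simp_all add: C0_simps star_mult)
  qed
qed

end

lemma (in linear_map) C0_map_closed:
  assumes bound: "\<And>x. x \<in> carrier A \<Longrightarrow> nrm B (f x) \<le> C * nrm A x" and "C \<ge> 0"
    and h: "h \<in> carrier (C0 X A)"
  shows "(\<lambda>x\<in>topspace X. f (h x)) \<in> carrier (C0 X B)"
proof (rule C0_memI[where c = C, OF B.normed_module_axioms A.normed_module_axioms h h])
  fix x assume x: "x \<in> topspace X"
  note app = A.C0_app_closed[OF h]
  \<comment> \<open>The criterion is used with \<open>h\<close> in both slots, so its right-hand
    side contains every term twice.\<close>
  have double: "nrm B (f z) \<le> C * (nrm A z + nrm A z)" if "z \<in> carrier A" for z
  proof -
    have "C * nrm A z \<le> C * (nrm A z + nrm A z)"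
      using that \<open>C \<ge> 0\<close> by (intro mult_left_mono) (auto simp: A.nrm_nonneg)
    then show ?thesis
      using bound[OF that] by linarith
  qed
  show "(\<lambda>x\<in>topspace X. f (h x)) x \<in> carrier B"
    "nrm B ((\<lambda>x\<in>topspace X. f (h x)) x) \<le> C * (nrm A (h x) + nrm A (h x))"
    using x app double by (simp_all add: closed)
  fix y assume y: "y \<in> topspace X"
  show "nrm B ((\<lambda>x\<in>topspace X. f (h x)) y \<ominus>\<^bsub>B\<^esub> (\<lambda>x\<in>topspace X. f (h x)) x) \<le>
      C * (nrm A (h y \<ominus>\<^bsub>A\<^esub> h x) + nrm A (h y \<ominus>\<^bsub>A\<^esub> h x))"
    using x y app double[of "h y \<ominus>\<^bsub>A\<^esub> h x"] by (simp add: diff)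
qed simp

lemma nrm_C0_map_le:
  assumes A: "normed_module A" and nonempty: "topspace X \<noteq> {}"
    and bound: "\<And>x. x \<in> carrier A \<Longrightarrow> nrm B (f x) \<le> C * nrm A x" and "C \<ge> 0"
    and h: "h \<in> carrier (C0 X A)"
  shows "nrm (C0 X B) (\<lambda>x\<in>topspace X. f (h x)) \<le> C * nrm (C0 X A) h"
proof (rule nrm_C0_le[OF nonempty])
  fix x assume x: "x \<in> topspace X"
  have "nrm B (f (h x)) \<le> C * nrm A (h x)"
    using x h by (intro bound normed_module.C0_app_closed[OF A])
  also have "\<dots> \<le> C * nrm (C0 X A) h"
    using x h \<open>C \<ge> 0\<close> by (intro mult_left_mono normed_module.nrm_app_le_nrm_C0[OF A])
  finally show "nrm B ((\<lambda>x\<in>topspace X. f (h x)) x) \<le> C * nrm (C0 X A) h"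
    using x by simp
qed

text \<open>Composition with \<open>f\<close> and composition with its inverse are mutually inverse;
  they preserve \<open>C0\<close> and are bounded by the same constants because \<open>f\<close> and
  \<open>g\<close> are bounded linear.\<close>

lemma isomorphic_algebras_C0:
  fixes A :: "'a normed_alg" and B :: "'b normed_alg" and X :: "'x topology"
  assumes A: "banach_algebra A" and B: "banach_algebra B" and AB: "isomorphic_algebras A B"
    and nonempty: "topspace X \<noteq> {}"
  shows "isomorphic_algebras (C0 X A) (C0 X B)"
proof -
  interpret A: C0_of_banach_algebra A X
    using A nonempty by (intro C0_of_banach_algebra.intro C0_of_banach_algebra_axioms.intro)
  interpret B: C0_of_banach_algebra B X
    using B nonempty by (intro C0_of_banach_algebra.intro C0_of_banach_algebra_axioms.intro)
  obtain f where iso: "algebra_isomorphism A B f"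
    using AB by (auto simp: isomorphic_algebras_def)
  obtain g C D where f: "linear_map A B f" and g: "linear_map B A g"
    and gf: "\<And>x. x \<in> carrier A \<Longrightarrow> g (f x) = x" and fg: "\<And>y. y \<in> carrier B \<Longrightarrow> f (g y) = y"
    and f_mult: "\<And>x y. \<lbrakk>x \<in> carrier A; y \<in> carrier A\<rbrakk> \<Longrightarrow> f (x \<otimes>\<^bsub>A\<^esub> y) = f x \<otimes>\<^bsub>B\<^esub> f y"
    and C: "C > 0" "\<And>x. x \<in> carrier A \<Longrightarrow> nrm B (f x) \<le> C * nrm A x"
    and D: "D > 0" "\<And>y. y \<in> carrier B \<Longrightarrow> nrm A (g y) \<le> D * nrm B y"
    by (fact algebra_isomorphismE[OF A.normed.normed_module_axioms B.normed.normed_module_axioms iso])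
  interpret f: linear_map A B f by (rule f)
  interpret g: linear_map B A g by (rule g)
  let ?F = "\<lambda>h. \<lambda>x\<in>topspace X. f (h x)" and ?G = "\<lambda>h. \<lambda>x\<in>topspace X. g (h x)"
  have F_closed: "?F h \<in> carrier (C0 X B)" if "h \<in> carrier (C0 X A)" for h
    using that C by (intro f.C0_map_closed[where C = C]) auto
  have G_closed: "?G h \<in> carrier (C0 X A)" if "h \<in> carrier (C0 X B)" for h
    using that D by (intro g.C0_map_closed[where C = D]) auto
  note [simp] = A.C0_add_closed A.C0_smult_closed A.C0_mult_closed A.normed.C0_app_closed
    B.C0_add_closed B.C0_smult_closed B.C0_mult_closed B.normed.C0_app_closed
  have "algebra_isomorphism (C0 X A) (C0 X B) ?F"
  proof (rule algebra_isomorphismI)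
    show "linear_map (C0 X A) (C0 X B) ?F"
    proof (unfold_locales, goal_cases)
      case 1 then show ?case by (rule F_closed)
    next
      case 2 then show ?case
        by (intro C0_eqI[of _ X B] F_closed B.C0_add_closed A.C0_add_closed) (simp_all add: C0_simps f.add)
    next
      case 3 then show ?case
        by (intro C0_eqI[of _ X B] F_closed B.C0_smult_closed A.C0_smult_closed)
          (simp_all add: C0_simps f.scale)
    qed
    show "linear_map (C0 X B) (C0 X A) ?G"
    proof (unfold_locales, goal_cases)
      case 1 then show ?case by (rule G_closed)
    next
      case 2 then show ?case
        by (intro C0_eqI[of _ X A] G_closed B.C0_add_closed A.C0_add_closed) (simp_all add: C0_simps g.add)
    next
      case 3 then show ?case
        by (intro C0_eqI[of _ X A] G_closed B.C0_smult_closed A.C0_smult_closed)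
          (simp_all add: C0_simps g.scale)
    qed
    show "?G (?F h) = h" if "h \<in> carrier (C0 X A)" for h
      using that by (intro C0_eqI[of _ X A] G_closed F_closed) (simp_all add: gf)
    show "?F (?G h) = h" if "h \<in> carrier (C0 X B)" for h
      using that by (intro C0_eqI[of _ X B] G_closed F_closed) (simp_all add: fg)
    show "?F (h \<otimes>\<^bsub>C0 X A\<^esub> k) = ?F h \<otimes>\<^bsub>C0 X B\<^esub> ?F k"
      if "h \<in> carrier (C0 X A)" "k \<in> carrier (C0 X A)" for h k
      using that by (intro C0_eqI[of _ X B] F_closed A.C0_mult_closed B.C0_mult_closed)
        (simp_all add: C0_simps f_mult)
    show "nrm (C0 X B) (?F h) \<le> C * nrm (C0 X A) h" if "h \<in> carrier (C0 X A)" for h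
      using that C by (intro nrm_C0_map_le A.normed.normed_module_axioms nonempty) auto
    show "nrm (C0 X A) (?G h) \<le> D * nrm (C0 X B) h" if "h \<in> carrier (C0 X B)" for h
      using that D by (intro nrm_C0_map_le B.normed.normed_module_axioms nonempty) auto
  qed
  then show ?thesis
    by (auto simp: isomorphic_algebras_def)
qed

text \<open>Local compactness puts a neighbourhood \<open>U\<close> of \<open>x0\<close> into a
  compact \<open>K\<close>, and complete regularity separates \<open>x0\<close> from the complement
  of \<open>U\<close>; the bump is one minus the separating function.\<close>

lemma compactly_supported_bump:
  assumes "locally_compact_space X" "Hausdorff_space X" "x0 \<in> topspace X"
  obtains \<phi> :: "'x \<Rightarrow> real" and K where "continuous_map X euclideanreal \<phi>" "\<phi> x0 = 1"
    "\<And>x. x \<in> topspace X \<Longrightarrow> \<bar>\<phi> x\<bar> \<le> 1" "compactin X K" "\<And>x. x \<in> topspace X - K \<Longrightarrow> \<phi> x = 0"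
proof -
  obtain U K where U: "openin X U" "x0 \<in> U" and K: "compactin X K" "U \<subseteq> K"
    using assms unfolding locally_compact_space_def by metis
  have "completely_regular_space X"
    using assms locally_compact_regular_imp_completely_regular_space
      locally_compact_Hausdorff_imp_regular_space by blast
  moreover have "closedin X (topspace X - U)" "x0 \<in> topspace X - (topspace X - U)"
    using U assms by auto
  ultimately obtain \<psi> :: "'x \<Rightarrow> real" where \<psi>: "continuous_map X (top_of_set {0..1}) \<psi>" "\<psi> x0 = 0"
      "\<psi> ` (topspace X - U) \<subseteq> {1}"
    unfolding completely_regular_space_def by metis
  show ?thesis
  proof
    show "continuous_map X euclideanreal (\<lambda>x. 1 - \<psi> x)"
      using \<psi>(1) by (intro continuous_intros) (auto dest: continuous_map_into_fulltopology)
    show "\<bar>1 - \<psi> x\<bar> \<le> 1" if "x \<in> topspace X" for x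
      using \<psi>(1) that by (force simp: continuous_map_in_subtopology)
  qed (use \<psi> K in auto)
qed

text \<open>At a point where \<open>\<phi>\<close> is 1 this function takes the value
  \<open>a\<close>; it becomes the lift of \<open>a\<close> under evaluation.\<close>

lemma (in normed_module) bump_mem_C0:
  assumes cont: "continuous_map X euclideanreal \<phi>"
    and K: "compactin X K" "\<And>x. x \<in> topspace X - K \<Longrightarrow> \<phi> x = 0" and a: "a \<in> carrier A"
  shows "(\<lambda>x\<in>topspace X. complex_of_real (\<phi> x) \<odot> a) \<in> carrier (C0 X A)"
  unfolding mem_carrier_C0_iff
proof (intro conjI)
  show "vanishes_at_infinity X A (\<lambda>x\<in>topspace X. complex_of_real (\<phi> x) \<odot> a)"
    unfolding vanishes_at_infinity_def using K a by (auto intro!: exI[of _ K])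
  show "continuous_map X (norm_topology A) (\<lambda>x\<in>topspace X. complex_of_real (\<phi> x) \<odot> a)"
    unfolding continuous_map_norm_topology_iff
  proof (intro conjI ballI allI impI)
    fix x \<epsilon> assume x: "x \<in> topspace X" and \<epsilon>: "(\<epsilon>::real) > 0"
    \<comment> \<open>The added 1 keeps the denominator positive when \<open>a\<close> is
      zero.\<close>
    let ?r = "\<epsilon> / (nrm A a + 1)"
    have pos: "nrm A a + 1 > 0"
      using nrm_nonneg[OF a] by linarith
    let ?U = "{y \<in> topspace X. \<phi> y \<in> ball (\<phi> x) ?r}"
    have "nrm A (complex_of_real (\<phi> y) \<odot> a \<ominus> complex_of_real (\<phi> x) \<odot> a) < \<epsilon>" if "y \<in> ?U" for y
    proof -
      have "complex_of_real (\<phi> y) \<odot> a \<ominus> complex_of_real (\<phi> x) \<odot> a = complex_of_real (\<phi> y - \<phi> x) \<odot> a"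
        using scale_add_left[OF a, of "complex_of_real (\<phi> y)" "- complex_of_real (\<phi> x)"] a
        by (simp add: scale_minus_left M.minus_eq)
      then have "nrm A (complex_of_real (\<phi> y) \<odot> a \<ominus> complex_of_real (\<phi> x) \<odot> a) = \<bar>\<phi> y - \<phi> x\<bar> * nrm A a"
        using a by (simp only: nrm_smult norm_of_real)
      also have "\<dots> \<le> \<bar>\<phi> y - \<phi> x\<bar> * (nrm A a + 1)"
        by (intro mult_left_mono) auto
      also have "\<dots> < \<epsilon>"
        using that pos by (simp add: dist_real_def abs_minus_commute pos_less_divide_eq)
      finally show ?thesis .
    qed
    moreover have "openin X ?U"
      using cont by (rule openin_continuous_map_preimage) simp
    ultimately show "\<exists>U. openin X U \<and> x \<in> U \<and> (\<forall>y\<in>U. nrm A ((\<lambda>x\<in>topspace X. complex_of_real (\<phi> x) \<odot> a) y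
        \<ominus> (\<lambda>x\<in>topspace X. complex_of_real (\<phi> x) \<odot> a) x) < \<epsilon>)"
      using x \<epsilon> pos by (intro exI[of _ ?U]) auto
  qed (use a in simp)
qed simp

section \<open>Approximate units in commutative C*-algebras\<close>

context banach_algebra
begin

text \<open>
  The algebra need not have a unit, so \<open>1 + s k\<close> exists only as the operator \<open>shift s k\<close>.
\<close>

definition shift :: "real \<Rightarrow> 'a \<Rightarrow> 'a \<Rightarrow> 'a" where
  "shift s k x = x \<oplus> complex_of_real s \<odot> (k \<otimes> x)"

text \<open>Accretivity, in the sense of operator theory, of multiplication by \<open>k\<close>. It
  stands in for a spectrum in the closed right half-plane and makes the inverse of 1 + s k a
  contraction.\<close>

definition accretive :: "'a \<Rightarrow> bool" where
  "accretive k \<longleftrightarrow> k \<in> carrier A \<and> (\<forall>s\<ge>0. \<forall>x\<in>carrier A. nrm A x \<le> nrm A (shift s k x))"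

lemma shift_closed: "\<lbrakk>k \<in> carrier A; x \<in> carrier A\<rbrakk> \<Longrightarrow> shift s k x \<in> carrier A"
  by (simp add: shift_def mult_closed)

lemma shift_diff:
  assumes "k \<in> carrier A" "x \<in> carrier A" "y \<in> carrier A"
  shows "shift s k (x \<ominus> y) = shift s k x \<ominus> shift s k y"
proof -
  have "k \<otimes> x \<in> carrier A" "k \<otimes> y \<in> carrier A"
    using assms by (auto simp: mult_closed)
  then have "complex_of_real s \<odot> (k \<otimes> (x \<ominus> y)) = complex_of_real s \<odot> (k \<otimes> x) \<ominus> complex_of_real s \<odot> (k \<otimes> y)"
    and "complex_of_real s \<odot> (k \<otimes> x) \<in> carrier A" "complex_of_real s \<odot> (k \<otimes> y) \<in> carrier A"
    using assms by (simp_all add: mult_diff_distrib_right normed.scale_diff_right)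
  then show ?thesis
    unfolding shift_def using assms by algebra
qed

lemma shift_inj:
  assumes "accretive k" "s \<ge> 0" "x \<in> carrier A" "y \<in> carrier A" "shift s k x = shift s k y"
  shows "x = y"
proof -
  have k: "k \<in> carrier A"
    using assms by (simp add: accretive_def)
  have "nrm A (x \<ominus> y) \<le> nrm A (shift s k (x \<ominus> y))"
    using assms by (simp add: accretive_def)
  also have "shift s k (x \<ominus> y) = \<zero>"
    using assms k by (simp add: shift_diff shift_closed normed.diff_eq_zero_iff[THEN iffD2])
  finally show ?thesis
    using assms normed.nrm_zero nrm_nonneg[of "x \<ominus> y"] nrm_eq_zero_iff[of "x \<ominus> y"] normed.diff_eq_zero_iff
    by (metis M.minus_closed order_antisym)
qed

text \<open>
  If \<open>R\<close> inverts \<open>shift s k\<close>, the equation becomes the fixed point equation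
  \<open>y = R (d - \<tau> k y)\<close>, a contraction since \<open>R\<close> does not increase the norm. The step \<open>\<tau>\<close> does not
  depend on \<open>s\<close>, so finitely many steps reach every \<open>s\<close>.
\<close>

lemma shift_surj_step:
  assumes acc: "accretive k" and "s \<ge> 0" and "\<tau> \<ge> 0" and \<tau>: "\<tau> * nrm A k \<le> 1 / 2"
    and surj: "\<And>d. d \<in> carrier A \<Longrightarrow> \<exists>y\<in>carrier A. shift s k y = d"
    and d: "d \<in> carrier A"
  shows "\<exists>y\<in>carrier A. shift (s + \<tau>) k y = d"
proof -
  have k: "k \<in> carrier A"
    using acc by (simp add: accretive_def)
  obtain R where R: "\<And>d. d \<in> carrier A \<Longrightarrow> R d \<in> carrier A \<and> shift s k (R d) = d"
    using surj by metis
  define T where "T e = R (d \<ominus> complex_of_real \<tau> \<odot> (k \<otimes> e))" for e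
  have arg: "d \<ominus> complex_of_real \<tau> \<odot> (k \<otimes> e) \<in> carrier A" if "e \<in> carrier A" for e
    using that k d by (simp add: mult_closed)
  have T_closed: "T e \<in> carrier A" if "e \<in> carrier A" for e
    using R[OF arg[OF that]] by (simp add: T_def)
  have shift_T: "shift s k (T e) = d \<ominus> complex_of_real \<tau> \<odot> (k \<otimes> e)" if "e \<in> carrier A" for e
    using R[OF arg[OF that]] by (simp add: T_def)
  have contr: "norm_dist A (T e) (T e') \<le> 1 / 2 * norm_dist A e e'"
    if e: "e \<in> carrier A" and e': "e' \<in> carrier A" for e e'
  proof -
    have ke: "complex_of_real \<tau> \<odot> (k \<otimes> e) \<in> carrier A" "complex_of_real \<tau> \<odot> (k \<otimes> e') \<in> carrier A"
      using e e' k by (simp_all add: mult_closed)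
    have "nrm A (T e \<ominus> T e') \<le> nrm A (shift s k (T e \<ominus> T e'))"
      using acc \<open>s \<ge> 0\<close> e e' T_closed by (simp add: accretive_def)
    also have "shift s k (T e \<ominus> T e') =
        (d \<ominus> complex_of_real \<tau> \<odot> (k \<otimes> e)) \<ominus> (d \<ominus> complex_of_real \<tau> \<odot> (k \<otimes> e'))"
      using e e' k by (simp add: shift_diff T_closed shift_T)
    also have "\<dots> = complex_of_real \<tau> \<odot> (k \<otimes> e') \<ominus> complex_of_real \<tau> \<odot> (k \<otimes> e)"
      using d ke by algebra
    also have "\<dots> = complex_of_real \<tau> \<odot> (k \<otimes> (e' \<ominus> e))"
      using k e e' by (simp add: mult_diff_distrib_right normed.scale_diff_right mult_closed)
    also have "nrm A \<dots> = \<tau> * nrm A (k \<otimes> (e' \<ominus> e))"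
      using k e e' \<open>\<tau> \<ge> 0\<close> by (simp add: nrm_smult mult_closed)
    also have "\<dots> \<le> \<tau> * (nrm A k * nrm A (e' \<ominus> e))"
      using k e e' \<open>\<tau> \<ge> 0\<close> by (intro mult_left_mono nrm_mult) auto
    also have "\<dots> \<le> 1 / 2 * nrm A (e' \<ominus> e)"
      using mult_right_mono[OF \<tau> nrm_nonneg[of "e' \<ominus> e"]] e e' by (simp add: mult.assoc)
    finally show ?thesis
      using e e' T_closed normed.nrm_diff_commute[of e e'] by (simp add: norm_dist_def)
  qed
  obtain y where y: "y \<in> carrier A" "T y = y"
    using normed.metric.Banach_fixedpoint_thm[of T "1 / 2"] complete contr T_closed d
    by (metis Pi_I empty_iff divide_less_eq_1 one_less_numeral_iff semiring_norm(76) zero_less_numeral)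
  have ky: "k \<otimes> y \<in> carrier A"
    using y k by (simp add: mult_closed)
  have "shift (s + \<tau>) k y = shift s k y \<oplus> complex_of_real \<tau> \<odot> (k \<otimes> y)"
    using y ky by (simp add: shift_def normed.scale_add_left M.a_assoc)
  also have "\<dots> = d"
    using shift_T[OF y(1)] y ky d by (simp add: normed.diff_add_cancel)
  finally show ?thesis
    using y by blast
qed

lemma shift_surj:
  assumes acc: "accretive k" and "s \<ge> 0" and d: "d \<in> carrier A"
  shows "\<exists>y\<in>carrier A. shift s k y = d"
proof -
  have k: "k \<in> carrier A"
    using acc by (simp add: accretive_def)
  \<comment> \<open>Continuation from s = 0, where \<open>shift\<close> is the identity, in
    \<open>n\<close> equal steps: n > 2 s ||k|| makes the step s / n admissible for
    \<open>shift_surj_step\<close>, and the 1 keeps \<open>n\<close> positive.\<close>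
  obtain n :: nat where "max 1 (2 * s * nrm A k) < real n"
    using reals_Archimedean2 by blast
  then have n: "n > 0" "2 * s * nrm A k \<le> real n"
    by auto
  define \<tau> where "\<tau> = s / n"
  have \<tau>: "\<tau> \<ge> 0" "\<tau> * nrm A k \<le> 1 / 2"
    using n \<open>s \<ge> 0\<close> by (simp_all add: \<tau>_def field_simps)
  have "\<forall>d\<in>carrier A. \<exists>y\<in>carrier A. shift (real m * \<tau>) k y = d" for m :: nat
  proof (induction m)
    case 0
    then show ?case
      using k by (auto simp: shift_def mult_closed)
  next
    case (Suc m)
    then show ?case
      using shift_surj_step[OF acc _ \<tau>, of "real m * \<tau>"] \<tau>(1) by (simp add: algebra_simps)
  qed
  from this[of n] show ?thesis
    using d n by (simp add: \<tau>_def)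
qed

end

text \<open>With \<delta> = N - M the right-hand side is the square of N - \<theta> \<delta>, which
  falls linearly in \<theta> near 0, whereas the left-hand side falls only quadratically.\<close>

lemma quadratic_growth_contradiction:
  fixes N M c :: real
  assumes "0 \<le> M" "M < N" "c \<ge> 0"
    and le: "\<And>\<theta>. \<lbrakk>0 < \<theta>; \<theta> \<le> 1\<rbrakk> \<Longrightarrow> N\<^sup>2 - \<theta>\<^sup>2 * c \<le> ((1 - \<theta>) * N + \<theta> * M)\<^sup>2"
  shows False
proof -
  define \<delta> where "\<delta> = N - M"
  have \<delta>: "\<delta> > 0" "N > 0" "c + \<delta>\<^sup>2 > 0"
    using assms by (auto simp: \<delta>_def add_nonneg_pos)
  \<comment> \<open>Expanding the squares will give 2 N \<delta> <= \<theta> (c + \<delta>^2); this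
    \<theta> keeps that right-hand side at most N \<delta>.\<close>
  define \<theta> where "\<theta> = min 1 (N * \<delta> / (c + \<delta>\<^sup>2))"
  have "\<theta> \<le> N * \<delta> / (c + \<delta>\<^sup>2)"
    by (simp add: \<theta>_def)
  then have "\<theta> * (c + \<delta>\<^sup>2) \<le> N * \<delta>"
    using \<delta> by (simp add: pos_le_divide_eq)
  moreover have "0 < \<theta>" "\<theta> \<le> 1"
    using \<delta> by (simp_all add: \<theta>_def)
  ultimately have \<theta>: "0 < \<theta>" "\<theta> \<le> 1" "\<theta> * (c + \<delta>\<^sup>2) \<le> N * \<delta>"
    by blast+
  have "(1 - \<theta>) * N + \<theta> * M = N - \<theta> * \<delta>"
    by (simp add: \<delta>_def algebra_simps)
  then have "N\<^sup>2 - \<theta>\<^sup>2 * c \<le> (N - \<theta> * \<delta>)\<^sup>2"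
    using le[OF \<theta>(1,2)] by simp
  then have "\<theta> * (2 * (N * \<delta>)) \<le> \<theta> * (\<theta> * (c + \<delta>\<^sup>2))"
    by (simp add: power2_eq_square algebra_simps)
  then have "2 * (N * \<delta>) \<le> N * \<delta>"
    using \<theta> by simp
  then show False
    using \<delta> by simp
qed

section \<open>Contractive approximate units from the C*-identity\<close>

locale comm_cstar_algebra = cstar_algebra A star + comm_banach_algebra A
  for A :: "'a normed_alg" (structure) and star
begin

lemma mult_lcomm:
  "\<lbrakk>x \<in> carrier A; y \<in> carrier A; z \<in> carrier A\<rbrakk> \<Longrightarrow> x \<otimes> (y \<otimes> z) = y \<otimes> (x \<otimes> z)"
  by (metis mult_assoc mult_commute)

text \<open>
  The C*-identity bounds \<open>\<parallel>x + i t h x\<parallel>\<close> below by \<open>\<parallel>x\<parallel>\<close> up to an error quadratic in \<open>t\<close>; since the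
  norm is convex in \<open>t\<close>, it cannot drop below \<open>\<parallel>x\<parallel>\<close> anywhere.
\<close>

lemma nrm_imaginary_shift:
  assumes h: "h \<in> carrier A" "star h = h" and x: "x \<in> carrier A"
  shows "nrm A x \<le> nrm A (x \<oplus> (\<i> * complex_of_real t) \<odot> (h \<otimes> x))"
proof (rule ccontr)
  define e where "e t = x \<oplus> (\<i> * complex_of_real t) \<odot> (h \<otimes> x)" for t
  have hx: "h \<otimes> x \<in> carrier A"
    using h x by (simp add: mult_closed)
  have e_closed: "e t \<in> carrier A" for t
    using x hx by (simp add: e_def)
  assume "\<not> nrm A x \<le> nrm A (x \<oplus> (\<i> * complex_of_real t) \<odot> (h \<otimes> x))"
  then have less: "nrm A (e t) < nrm A x"
    by (simp add: e_def)
  \<comment> \<open>Since \<open>h\<close> is self-adjoint, the terms linear in r cancel in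
    \<open>star (e r) \<otimes> e r\<close>, leaving x* x plus r^2 times the square of h x; only a
    quadratic error remains.\<close>
  have low: "(nrm A x)\<^sup>2 - r\<^sup>2 * (nrm A h * nrm A x)\<^sup>2 \<le> (nrm A (e r))\<^sup>2" for r
  proof -
    let ?b = "\<i> * complex_of_real r"
    have xs: "star x \<in> carrier A"
      using x by (rule star_closed)
    have star_e: "star (e r) = star x \<oplus> (- ?b) \<odot> (star x \<otimes> h)"
      using x h hx by (simp add: e_def star_add star_smult star_mult)
    have P: "star x \<otimes> x \<in> carrier A" and Q: "star x \<otimes> (h \<otimes> x) \<in> carrier A"
      and S: "star (h \<otimes> x) \<otimes> (h \<otimes> x) \<in> carrier A"
      using x xs h hx by (simp_all add: mult_closed star_closed)
    have "star (e r) \<otimes> e r = star x \<otimes> x \<oplus> (- ?b) \<odot> (star x \<otimes> (h \<otimes> x)) \<oplus>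
        (?b \<odot> (star x \<otimes> (h \<otimes> x)) \<oplus> (- ?b * ?b) \<odot> (star (h \<otimes> x) \<otimes> (h \<otimes> x)))"
      unfolding star_e using x xs h hx
      by (simp add: e_def mult_distr_left mult_distr_right smult_mult_left smult_mult_right
          mult_closed normed.scale_scale star_mult mult_assoc normed.scale_add_right)
    also have "- ?b * ?b = complex_of_real (r\<^sup>2)"
      by (simp add: power2_eq_square algebra_simps)
    also have "star x \<otimes> x \<oplus> (- ?b) \<odot> (star x \<otimes> (h \<otimes> x)) \<oplus>
        (?b \<odot> (star x \<otimes> (h \<otimes> x)) \<oplus> complex_of_real (r\<^sup>2) \<odot> (star (h \<otimes> x) \<otimes> (h \<otimes> x))) =
        star x \<otimes> x \<oplus> complex_of_real (r\<^sup>2) \<odot> (star (h \<otimes> x) \<otimes> (h \<otimes> x))"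
    proof -
      have "?b \<odot> (star x \<otimes> (h \<otimes> x)) \<in> carrier A"
        "complex_of_real (r\<^sup>2) \<odot> (star (h \<otimes> x) \<otimes> (h \<otimes> x)) \<in> carrier A"
        using Q S by simp_all
      then show ?thesis
        unfolding normed.scale_minus_left[OF Q] using P
        by (simp add: M.a_assoc M.r_neg1)
    qed
    finally have eq: "star (e r) \<otimes> e r =
        star x \<otimes> x \<oplus> complex_of_real (r\<^sup>2) \<odot> (star (h \<otimes> x) \<otimes> (h \<otimes> x))" .
    let ?S = "complex_of_real (r\<^sup>2) \<odot> (star (h \<otimes> x) \<otimes> (h \<otimes> x))"
    have "star x \<otimes> x = star (e r) \<otimes> e r \<ominus> ?S"
      unfolding eq using P S by (simp add: M.minus_eq M.a_assoc M.r_neg)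
    then have "nrm A (star x \<otimes> x) \<le> nrm A (star (e r) \<otimes> e r) + nrm A ?S"
      using normed.nrm_diff_le[of "star (e r) \<otimes> e r" ?S] S e_closed
      by (simp add: mult_closed star_closed)
    then have "(nrm A x)\<^sup>2 \<le> (nrm A (e r))\<^sup>2 + r\<^sup>2 * (nrm A (h \<otimes> x))\<^sup>2"
      using x hx e_closed S by (simp add: cstar_identity nrm_smult norm_power)
    moreover have "r\<^sup>2 * (nrm A (h \<otimes> x))\<^sup>2 \<le> r\<^sup>2 * (nrm A h * nrm A x)\<^sup>2"
      using x h hx by (intro mult_left_mono power_mono nrm_mult nrm_nonneg) auto
    ultimately show ?thesis
      by linarith
  qed
  show False
  proof (rule quadratic_growth_contradiction[OF nrm_nonneg[OF e_closed] less])
    show "t\<^sup>2 * (nrm A h * nrm A x)\<^sup>2 \<ge> 0"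
      by simp
    fix \<theta> :: real assume \<theta>: "0 < \<theta>" "\<theta> \<le> 1"
    \<comment> \<open>\<open>e\<close> is affine in its parameter, so this point is a convex
      combination of \<open>x\<close>, its value at 0, and \<open>e t\<close>.\<close>
    have "e (\<theta> * t) = complex_of_real (1 - \<theta>) \<odot> x \<oplus> complex_of_real \<theta> \<odot> e t"
    proof -
      have "complex_of_real (1 - \<theta>) \<odot> x \<oplus> complex_of_real \<theta> \<odot> e t =
          (complex_of_real (1 - \<theta>) \<odot> x \<oplus> complex_of_real \<theta> \<odot> x) \<oplus> (\<i> * complex_of_real (\<theta> * t)) \<odot> (h \<otimes> x)"
        using x hx by (simp add: e_def normed.scale_add_right normed.scale_scale M.a_assoc mult.left_commute)
      also have "complex_of_real (1 - \<theta>) \<odot> x \<oplus> complex_of_real \<theta> \<odot> x = x"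
        using x by (simp flip: normed.scale_add_left)
      finally show ?thesis
        by (simp add: e_def)
    qed
    then have "nrm A (e (\<theta> * t)) \<le> (1 - \<theta>) * nrm A x + \<theta> * nrm A (e t)"
      using nrm_triangle[of "complex_of_real (1 - \<theta>) \<odot> x" "complex_of_real \<theta> \<odot> e t"] x e_closed \<theta>
      by (simp add: nrm_smult del: of_real_diff)
    then have "(nrm A (e (\<theta> * t)))\<^sup>2 \<le> ((1 - \<theta>) * nrm A x + \<theta> * nrm A (e t))\<^sup>2"
      by (intro power_mono nrm_nonneg e_closed)
    then show "(nrm A x)\<^sup>2 - \<theta>\<^sup>2 * (t\<^sup>2 * (nrm A h * nrm A x)\<^sup>2) \<le> ((1 - \<theta>) * nrm A x + \<theta> * nrm A (e t))\<^sup>2"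
      using low[of "\<theta> * t"] by (simp add: power_mult_distrib mult.assoc)
  qed
qed

text \<open>
  Here \<open>1 + s h\<^sup>2\<close> factors as \<open>(1 + i r h) (1 - i r h)\<close> with \<open>r\<^sup>2 = s\<close>.
\<close>

lemma accretive_square:
  assumes h: "h \<in> carrier A" "star h = h"
  shows "accretive (h \<otimes> h)"
  unfolding accretive_def
proof (intro conjI allI impI ballI)
  show "h \<otimes> h \<in> carrier A"
    using h by (simp add: mult_closed)
  fix s :: real and x assume "s \<ge> 0" and x: "x \<in> carrier A"
  define r where "r = sqrt s"
  let ?b = "\<i> * complex_of_real r"
  \<comment> \<open>This is (1 - i r h) x. The bound of \<open>nrm_imaginary_shift\<close> holds for
    either sign of its parameter, so it applies to both factors in turn.\<close>
  define y where "y = x \<oplus> (\<i> * complex_of_real (- r)) \<odot> (h \<otimes> x)"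
  have hx: "h \<otimes> x \<in> carrier A" and hhx: "h \<otimes> (h \<otimes> x) \<in> carrier A"
    using h x by (simp_all add: mult_closed)
  have y: "y \<in> carrier A"
    using x hx by (simp add: y_def)
  have "y \<oplus> ?b \<odot> (h \<otimes> y) = (x \<oplus> (- ?b) \<odot> (h \<otimes> x)) \<oplus> (?b \<odot> (h \<otimes> x) \<oplus> (?b * - ?b) \<odot> (h \<otimes> (h \<otimes> x)))"
    using h x hx hhx
    by (simp add: y_def mult_distr_right smult_mult_right normed.scale_add_right normed.scale_scale)
  also have "?b * - ?b = complex_of_real s"
    using \<open>s \<ge> 0\<close> by (simp add: r_def algebra_simps flip: of_real_mult)
  also have "(x \<oplus> (- ?b) \<odot> (h \<otimes> x)) \<oplus> (?b \<odot> (h \<otimes> x) \<oplus> complex_of_real s \<odot> (h \<otimes> (h \<otimes> x))) =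
      x \<oplus> complex_of_real s \<odot> (h \<otimes> (h \<otimes> x))"
    unfolding normed.scale_minus_left[OF hx] using x hx hhx by (simp add: M.a_assoc M.r_neg1)
  also have "\<dots> = shift s (h \<otimes> h) x"
    using h x by (simp add: shift_def mult_assoc)
  finally have "shift s (h \<otimes> h) x = y \<oplus> ?b \<odot> (h \<otimes> y)"
    by simp
  moreover have "nrm A x \<le> nrm A y"
    unfolding y_def by (rule nrm_imaginary_shift[OF h x])
  moreover have "nrm A y \<le> nrm A (y \<oplus> ?b \<odot> (h \<otimes> y))"
    by (rule nrm_imaginary_shift[OF h y])
  ultimately show "nrm A x \<le> nrm A (shift s (h \<otimes> h) x)"
    by simp
qed

text \<open>
  The witness is \<open>u = s h\<^sup>2 (1 + s h\<^sup>2)\<^sup>-\<^sup>1\<close>, so that \<open>1 - u\<close> is the contractive inverse of \<open>1 + s h\<^sup>2\<close>.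
\<close>

lemma resolvent_unit:
  assumes h: "h \<in> carrier A" "star h = h" and "s \<ge> 0"
  obtains u y where "u \<in> carrier A" "y \<in> carrier A" "u = y \<otimes> h" "star u = u"
    "\<And>x. x \<in> carrier A \<Longrightarrow> nrm A (x \<ominus> u \<otimes> x) \<le> nrm A x"
    "complex_of_real s \<odot> (h \<otimes> h \<ominus> u \<otimes> (h \<otimes> h)) = u" "nrm A u \<le> 2"
proof -
  define k where "k = h \<otimes> h"
  have k: "k \<in> carrier A" and star_k: "star k = k"
    using h by (simp_all add: k_def mult_closed star_mult)
  have acc: "accretive k"
    unfolding k_def by (rule accretive_square[OF h])
  \<comment> \<open>The equation is solved for \<open>h\<close>, not for
    \<open>h \<otimes> h\<close>, so that the unit s y h is visibly a multiple of
    \<open>h\<close>.\<close>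
  obtain y where y: "y \<in> carrier A" and shift_y: "shift s k y = h"
    using shift_surj[OF acc \<open>s \<ge> 0\<close> h(1)] by blast
  define c where "c = complex_of_real s"
  have h_eq: "y \<oplus> c \<odot> (k \<otimes> y) = h"
    using shift_y by (simp add: shift_def c_def)
  have star_y: "star y = y"
  \<comment> \<open>\<open>star y\<close> solves the same equation as \<open>y\<close>, because
    \<open>k\<close>, \<open>h\<close> and s are self-adjoint; solutions are unique.\<close>
  proof (rule shift_inj[OF acc \<open>s \<ge> 0\<close> star_closed[OF y] y])
    have "star (shift s k y) = shift s k (star y)"
      using y k by (simp add: shift_def star_add star_smult star_mult star_k mult_closed
          mult_commute star_closed)
    then show "shift s k (star y) = shift s k y"
      using shift_y h by simp
  qed
  define u where "u = c \<odot> (y \<otimes> h)"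
  have u: "u \<in> carrier A"
    using y h by (simp add: u_def mult_closed)
  have star_u: "star u = u"
    using y h by (simp add: u_def c_def star_smult star_mult star_y mult_closed mult_commute)
  \<comment> \<open>In unital notation s k = (1 + s k) u, which says that 1 - u inverts 1 + s
    k.\<close>
  have ck: "c \<odot> k = u \<oplus> c \<odot> (k \<otimes> u)"
  proof -
    have "c \<odot> k = c \<odot> (h \<otimes> h)"
      by (simp add: k_def)
    also have "\<dots> = c \<odot> ((y \<oplus> c \<odot> (k \<otimes> y)) \<otimes> h)"
      by (simp only: h_eq)
    also have "\<dots> = u \<oplus> c \<odot> (k \<otimes> u)"
      using y h k by (simp add: u_def mult_distr_left smult_mult_left smult_mult_right
          normed.scale_add_right mult_closed mult_assoc)
    finally show ?thesis .
  qed
  have contr: "nrm A (x \<ominus> u \<otimes> x) \<le> nrm A x" if x: "x \<in> carrier A" for x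
  proof -
    have "u \<otimes> x \<in> carrier A" "c \<odot> (k \<otimes> (u \<otimes> x)) \<in> carrier A"
      using u x k by (simp_all add: mult_closed)
    moreover have "c \<odot> (k \<otimes> x) = u \<otimes> x \<oplus> c \<odot> (k \<otimes> (u \<otimes> x))"
      using arg_cong[OF ck, of "\<lambda>z. z \<otimes> x"] u x k
      by (simp add: mult_distr_left smult_mult_left mult_assoc mult_closed)
    ultimately have "shift s k (x \<ominus> u \<otimes> x) = (x \<ominus> u \<otimes> x) \<oplus> (u \<otimes> x \<oplus> c \<odot> (k \<otimes> (u \<otimes> x)) \<ominus> c \<odot> (k \<otimes> (u \<otimes> x)))"
      using x k by (simp add: shift_def c_def[symmetric] mult_diff_distrib_right
          normed.scale_diff_right mult_closed)
    also have "\<dots> = x"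
      using x \<open>u \<otimes> x \<in> carrier A\<close> \<open>c \<odot> (k \<otimes> (u \<otimes> x)) \<in> carrier A\<close> by algebra
    finally show ?thesis
      using acc \<open>s \<ge> 0\<close> x u by (metis accretive_def M.minus_closed mult_closed)
  qed
  \<comment> \<open>As u is self-adjoint, its squared norm is the norm of u^2, and u^2 differs from
    u by the contractive image of u. The resulting 2 is not sharp, but any constant independent of s
    will do.\<close>
  have "(nrm A u)\<^sup>2 \<le> nrm A u + nrm A u"
  proof -
    have "(nrm A u)\<^sup>2 = nrm A (u \<otimes> u)"
      using cstar_identity[OF u] star_u by simp
    also have "\<dots> \<le> nrm A u + nrm A (u \<otimes> u \<ominus> u)"
      using u by (intro normed.nrm_le_add_diff) (simp_all add: mult_closed)
    also have "nrm A (u \<otimes> u \<ominus> u) = nrm A (u \<ominus> u \<otimes> u)"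
      using u by (intro normed.nrm_diff_commute) (simp_all add: mult_closed)
    also have "\<dots> \<le> nrm A u"
      by (rule contr[OF u])
    finally show ?thesis
      by simp
  qed
  then have "nrm A u * nrm A u \<le> 2 * nrm A u"
    by (simp add: power2_eq_square)
  then have "nrm A u \<le> 2"
    using nrm_nonneg[OF u] by (cases "nrm A u = 0") auto
  moreover have "c \<odot> (k \<ominus> u \<otimes> k) = u"
  proof -
    have "c \<odot> (k \<otimes> u) \<in> carrier A"
      using u k by (simp add: mult_closed)
    then have "u \<oplus> c \<odot> (k \<otimes> u) \<ominus> c \<odot> (k \<otimes> u) = u"
      using u by algebra
    then show ?thesis
      using u k ck by (simp add: normed.scale_diff_right mult_closed mult_commute[of u k])
  qed
  moreover have "u = (c \<odot> y) \<otimes> h"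
    using y h by (simp add: u_def smult_mult_left)
  ultimately show ?thesis
    using that[of u "c \<odot> y"] u y star_u contr by (simp add: c_def k_def)
qed

text \<open>
  With \<open>w = j - u j\<close> one has \<open>w\<^sup>* w = (1 - u)\<^sup>2 h\<close>, so two applications of the C*-identity give
  \<open>\<parallel>w\<parallel>\<^sup>4 = \<parallel>(1 - u)\<^sup>4 h\<^sup>2\<parallel> \<le> \<parallel>(1 - u) h\<^sup>2\<parallel> = \<parallel>u\<parallel> / s \<le> 2 / s\<close>.
\<close>

lemma approximate_unit:
  assumes j: "j \<in> carrier A" and "\<epsilon> > 0"
  obtains u z where "u \<in> carrier A" "z \<in> carrier A" "u = z \<otimes> j" "star u = u"
    "\<And>x. x \<in> carrier A \<Longrightarrow> nrm A (x \<ominus> u \<otimes> x) \<le> nrm A x" "nrm A (j \<ominus> u \<otimes> j) < \<epsilon>"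
proof -
  define h where "h = star j \<otimes> j"
  have h: "h \<in> carrier A" and star_h: "star h = h"
    using j by (simp_all add: h_def mult_closed star_closed star_mult star_star)
  \<comment> \<open>Chosen so that the final bound 2 / s equals two thirds of \<epsilon>^4.\<close>
  define s where "s = 3 / \<epsilon> ^ 4"
  have "s > 0"
    using \<open>\<epsilon> > 0\<close> by (simp add: s_def)
  obtain u y where u: "u \<in> carrier A" and y: "y \<in> carrier A" and u_eq: "u = y \<otimes> h"
    and star_u: "star u = u" and contr: "\<And>x. x \<in> carrier A \<Longrightarrow> nrm A (x \<ominus> u \<otimes> x) \<le> nrm A x"
    and s_eq: "complex_of_real s \<odot> (h \<otimes> h \<ominus> u \<otimes> (h \<otimes> h)) = u" and "nrm A u \<le> 2"
    by (fact resolvent_unit[OF h star_h less_imp_le[OF \<open>s > 0\<close>]])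
  define V where "V x = x \<ominus> u \<otimes> x" for x
  have V_closed: "V x \<in> carrier A" if "x \<in> carrier A" for x
    using that u by (simp add: V_def mult_closed)
  have V_mult: "V x \<otimes> z = V (x \<otimes> z)" "x \<otimes> V z = V (x \<otimes> z)"
    if "x \<in> carrier A" "z \<in> carrier A" for x z
    using that u by (simp_all add: V_def mult_diff_distrib_left mult_diff_distrib_right mult_closed
        mult_assoc mult_lcomm)
  have star_V: "star (V x) = V (star x)" if "x \<in> carrier A" for x
    using that u by (simp add: V_def star_diff star_mult mult_closed star_u mult_commute star_closed)
  have V_le: "nrm A (V x) \<le> nrm A x" if "x \<in> carrier A" for x
    using contr[OF that] by (simp add: V_def)
  define w where "w = V j"
  define p where "p = V (V h)"
  have w: "w \<in> carrier A" and p: "p \<in> carrier A"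
    using j h by (simp_all add: w_def p_def V_closed)
  have "star w \<otimes> w = p"
    using j by (simp add: w_def p_def h_def star_V V_mult V_closed star_closed)
  moreover have "star p = p"
    using h by (simp add: p_def star_V V_closed star_h)
  moreover have "p \<otimes> p = V (V (V (V (h \<otimes> h))))"
    using h by (simp add: p_def V_mult V_closed mult_closed)
  ultimately have "((nrm A w)\<^sup>2)\<^sup>2 = nrm A (V (V (V (V (h \<otimes> h)))))"
    using cstar_identity[OF w] cstar_identity[OF p] by simp
  also have "\<dots> \<le> nrm A (V (V (V (h \<otimes> h))))"
    using h by (intro V_le V_closed mult_closed)
  also have "\<dots> \<le> nrm A (V (V (h \<otimes> h)))"
    using h by (intro V_le V_closed mult_closed)
  also have "\<dots> \<le> nrm A (V (h \<otimes> h))"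
    using h by (intro V_le V_closed mult_closed)
  also have "\<dots> \<le> 2 / s"
  proof -
    have "s * nrm A (V (h \<otimes> h)) = nrm A u"
      using nrm_smult[of "V (h \<otimes> h)" "complex_of_real s"] h s_eq \<open>s > 0\<close>
      by (simp add: V_closed mult_closed flip: V_def)
    then show ?thesis
      using \<open>nrm A u \<le> 2\<close> \<open>s > 0\<close> by (simp add: field_simps)
  qed
  also have "\<dots> < \<epsilon> ^ 4"
    using \<open>\<epsilon> > 0\<close> by (simp add: s_def)
  finally have "nrm A w ^ 4 < \<epsilon> ^ 4"
    by simp
  then have "nrm A w < \<epsilon>"
    using \<open>\<epsilon> > 0\<close> by (simp add: power_less_imp_less_base)
  \<comment> \<open>With h = j* j a multiple of \<open>h\<close> is a multiple of \<open>j\<close>,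
    so \<open>u\<close> lies in every ideal containing \<open>j\<close>.\<close>
  moreover have "u = (y \<otimes> star j) \<otimes> j"
    using y j by (simp add: u_eq h_def mult_assoc star_closed)
  ultimately show ?thesis
    using that[of u "y \<otimes> star j"] u y j star_u contr
    by (simp add: w_def V_def mult_closed star_closed)
qed

end

section \<open>Quotients of commutative C*-algebras\<close>

text \<open>Abstracts the evaluation map: \<open>p_lift\<close> is surjectivity with control of the
  norm, the constant that an open mapping argument would give. \<open>M\<close> may have any
  sign.\<close>

locale cstar_quotient = D: comm_cstar_algebra D star + A: banach_algebra A + p: linear_map D A p
  for D :: "'d normed_alg" and star and A :: "'a normed_alg" and p +
  fixes C M :: real
  assumes p_mult: "\<lbrakk>x \<in> carrier D; y \<in> carrier D\<rbrakk> \<Longrightarrow> p (x \<otimes>\<^bsub>D\<^esub> y) = p x \<otimes>\<^bsub>A\<^esub> p y"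
    and C_pos: "C > 0" and p_bound: "x \<in> carrier D \<Longrightarrow> nrm A (p x) \<le> C * nrm D x"
    and p_lift: "a \<in> carrier A \<Longrightarrow> \<exists>x\<in>carrier D. p x = a \<and> nrm D x \<le> M * nrm A a"
begin

text \<open>The quotient norm of D modulo the kernel of \<open>p\<close>, transported to
  \<open>A\<close>: the fibre over \<open>a\<close> is the coset, so no space of cosets has to be
  built.\<close>

definition qnrm :: "'a \<Rightarrow> real" where
  "qnrm a = (INF x\<in>{x \<in> carrier D. p x = a}. nrm D x)"

lemma qnrm_bdd_below: "bdd_below (nrm D ` {x \<in> carrier D. p x = a})"
  by (rule bdd_belowI2[of _ 0]) (simp add: D.nrm_nonneg)

lemma qnrm_le: "x \<in> carrier D \<Longrightarrow> qnrm (p x) \<le> nrm D x"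
  unfolding qnrm_def by (rule cINF_lower[OF qnrm_bdd_below]) simp

lemma le_qnrm:
  assumes "a \<in> carrier A" "\<And>x. \<lbrakk>x \<in> carrier D; p x = a\<rbrakk> \<Longrightarrow> c \<le> nrm D x"
  shows "c \<le> qnrm a"
  unfolding qnrm_def using assms p_lift[of a] by (intro cINF_greatest) auto

lemma qnrm_nonneg: "a \<in> carrier A \<Longrightarrow> 0 \<le> qnrm a"
  by (rule le_qnrm) (simp_all add: D.nrm_nonneg)

text \<open>Carries an estimate with a factor from all lifts over to the infimum; iterating it over
  two fibres handles products.\<close>

lemma le_mult_qnrm:
  assumes a: "a \<in> carrier A" and "k \<ge> 0"
    and le: "\<And>x. \<lbrakk>x \<in> carrier D; p x = a\<rbrakk> \<Longrightarrow> c \<le> k * nrm D x"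
  shows "c \<le> k * qnrm a"
\<comment> \<open>For k = 0 division is impossible, but some lift exists and already gives c <=
  0.\<close>
proof (cases "k = 0")
  case True
  then show ?thesis
    using p_lift[OF a] le by force
next
  case False
  then have "c / k \<le> qnrm a"
    using a le \<open>k \<ge> 0\<close> by (intro le_qnrm) (auto simp: field_simps)
  then show ?thesis
    using False \<open>k \<ge> 0\<close> by (simp add: field_simps)
qed

text \<open>Together with \<open>nrm_le_qnrm\<close> this is the equivalence of the two norms:
  bounded lifts give this half, boundedness of \<open>p\<close> the other.\<close>

lemma qnrm_le_nrm:
  assumes "a \<in> carrier A"
  shows "qnrm a \<le> M * nrm A a"
  using p_lift[OF assms] qnrm_le by force

lemma nrm_le_qnrm:
  assumes "a \<in> carrier A"
  shows "nrm A a \<le> C * qnrm a"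
  using assms C_pos p_bound by (intro le_mult_qnrm) auto

lemma qnrm_eq_zero_iff:
  assumes a: "a \<in> carrier A"
  shows "qnrm a = 0 \<longleftrightarrow> a = \<zero>\<^bsub>A\<^esub>"
proof
  assume "qnrm a = 0"
  then have "nrm A a = 0"
    using nrm_le_qnrm[OF a] A.nrm_nonneg[OF a] by simp
  then show "a = \<zero>\<^bsub>A\<^esub>"
    using a A.nrm_eq_zero_iff by simp
next
  assume "a = \<zero>\<^bsub>A\<^esub>"
  then show "qnrm a = 0"
    using qnrm_le_nrm[OF a] qnrm_nonneg[OF a] by simp
qed

lemma qnrm_triangle:
  assumes a: "a \<in> carrier A" and b: "b \<in> carrier A"
  shows "qnrm (a \<oplus>\<^bsub>A\<^esub> b) \<le> qnrm a + qnrm b"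
proof -
  \<comment> \<open>The infimum over the lifts of \<open>a\<close> is taken with the lift of
    \<open>b\<close> fixed, then the one over the lifts of \<open>b\<close>.\<close>
  have "qnrm (a \<oplus>\<^bsub>A\<^esub> b) - nrm D y \<le> qnrm a" if y: "y \<in> carrier D" "p y = b" for y
  proof (rule le_qnrm[OF a])
    fix x assume x: "x \<in> carrier D" "p x = a"
    show "qnrm (a \<oplus>\<^bsub>A\<^esub> b) - nrm D y \<le> nrm D x"
      using qnrm_le[of "x \<oplus>\<^bsub>D\<^esub> y"] D.nrm_triangle[of x y] x y by (simp add: p.add)
  qed
  then have "qnrm (a \<oplus>\<^bsub>A\<^esub> b) - qnrm a \<le> qnrm b"
    using b by (intro le_qnrm) (auto simp: algebra_simps)
  then show ?thesis
    by simp
qed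

lemma qnrm_mult:
  assumes a: "a \<in> carrier A" and b: "b \<in> carrier A"
  shows "qnrm (a \<otimes>\<^bsub>A\<^esub> b) \<le> qnrm a * qnrm b"
proof (rule le_mult_qnrm[OF b qnrm_nonneg[OF a]])
  fix y assume y: "y \<in> carrier D" "p y = b"
  have "qnrm (a \<otimes>\<^bsub>A\<^esub> b) \<le> nrm D y * qnrm a"
  proof (rule le_mult_qnrm[OF a D.nrm_nonneg[OF y(1)]])
    fix x assume x: "x \<in> carrier D" "p x = a"
    show "qnrm (a \<otimes>\<^bsub>A\<^esub> b) \<le> nrm D y * nrm D x"
      using qnrm_le[of "x \<otimes>\<^bsub>D\<^esub> y"] D.nrm_mult[of x y] x y
      by (simp add: p_mult D.mult_closed mult.commute)
  qed
  then show "qnrm (a \<otimes>\<^bsub>A\<^esub> b) \<le> qnrm a * nrm D y"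
    by (simp add: mult.commute)
qed

lemma qnrm_smult:
  assumes a: "a \<in> carrier A"
  shows "qnrm (c \<odot>\<^bsub>A\<^esub> a) = cmod c * qnrm a"
proof -
  have le: "qnrm (c \<odot>\<^bsub>A\<^esub> b) \<le> cmod c * qnrm b" if b: "b \<in> carrier A" for c b
  proof (rule le_mult_qnrm[OF b])
    fix x assume x: "x \<in> carrier D" "p x = b"
    show "qnrm (c \<odot>\<^bsub>A\<^esub> b) \<le> cmod c * nrm D x"
      using qnrm_le[of "c \<odot>\<^bsub>D\<^esub> x"] x by (simp add: p.scale D.nrm_smult)
  qed simp
  show ?thesis
  proof (cases "c = 0")
    case True
    then show ?thesis
      using a qnrm_eq_zero_iff[of "\<zero>\<^bsub>A\<^esub>"] by simp
  next
    case False
    then have "qnrm a \<le> cmod (inverse c) * qnrm (c \<odot>\<^bsub>A\<^esub> a)"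
      using le[of "c \<odot>\<^bsub>A\<^esub> a" "inverse c"] a by (simp add: A.normed.scale_scale)
    then have "cmod c * qnrm a \<le> qnrm (c \<odot>\<^bsub>A\<^esub> a)"
      using False by (simp add: norm_divide field_simps)
    then show ?thesis
      using le[OF a, of c] by simp
  qed
qed

text \<open>The kernel is an ideal, so it contains \<open>u\<close>: replacing x by (1 - u) x
  changes the lift but not its image.\<close>

lemma p_mult_kernel:
  assumes "j \<in> carrier D" "p j = \<zero>\<^bsub>A\<^esub>" "z \<in> carrier D" "u = z \<otimes>\<^bsub>D\<^esub> j" "x \<in> carrier D"
  shows "p (x \<ominus>\<^bsub>D\<^esub> u \<otimes>\<^bsub>D\<^esub> x) = p x"
  using assms
  by (simp add: p.diff p_mult D.mult_closed A.mult_zero_left A.mult_zero_right p.closed)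

text \<open>The element j* - u j* has the same image as j*, and it is the adjoint of j - u j, whose
  norm is arbitrarily small; the image of j* therefore has norm zero.\<close>

lemma kernel_star:
  assumes j: "j \<in> carrier D" "p j = \<zero>\<^bsub>A\<^esub>"
  shows "p (star j) = \<zero>\<^bsub>A\<^esub>"
proof -
  have sj: "star j \<in> carrier D"
    using j D.star_closed by blast
  have "nrm A (p (star j)) \<le> 0 + \<epsilon>" if "\<epsilon> > 0" for \<epsilon>
  proof -
    have "\<epsilon> / C > 0"
      using that C_pos by simp
    obtain u z where u: "u \<in> carrier D" "z \<in> carrier D" "u = z \<otimes>\<^bsub>D\<^esub> j" "star u = u"
      and small: "nrm D (j \<ominus>\<^bsub>D\<^esub> u \<otimes>\<^bsub>D\<^esub> j) < \<epsilon> / C"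
      using D.approximate_unit[OF j(1) \<open>\<epsilon> / C > 0\<close>] by metis
    have "p (star j) = p (star j \<ominus>\<^bsub>D\<^esub> u \<otimes>\<^bsub>D\<^esub> star j)"
      using p_mult_kernel[OF j u(2,3) sj] by simp
    also have "star j \<ominus>\<^bsub>D\<^esub> u \<otimes>\<^bsub>D\<^esub> star j = star (j \<ominus>\<^bsub>D\<^esub> u \<otimes>\<^bsub>D\<^esub> j)"
      using u(1,4) j sj by (simp add: D.star_diff D.star_mult D.mult_closed D.mult_commute)
    also have "nrm A (p (star (j \<ominus>\<^bsub>D\<^esub> u \<otimes>\<^bsub>D\<^esub> j))) \<le> C * nrm D (star (j \<ominus>\<^bsub>D\<^esub> u \<otimes>\<^bsub>D\<^esub> j))"
      using u(1) j by (intro p_bound) (simp add: D.star_closed D.mult_closed)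
    also have "nrm D (star (j \<ominus>\<^bsub>D\<^esub> u \<otimes>\<^bsub>D\<^esub> j)) = nrm D (j \<ominus>\<^bsub>D\<^esub> u \<otimes>\<^bsub>D\<^esub> j)"
      using u(1) j by (intro D.nrm_star) (simp add: D.mult_closed)
    also have "C * \<dots> \<le> C * (\<epsilon> / C)"
      using small C_pos by (intro mult_left_mono) auto
    finally show ?thesis
      using C_pos by simp
  qed
  then have "nrm A (p (star j)) \<le> 0"
    by (rule field_le_epsilon)
  then show ?thesis
    using A.nrm_nonneg[of "p (star j)"] A.nrm_eq_zero_iff[of "p (star j)"] p.closed[OF sj] by simp
qed

text \<open>An arbitrary lift is taken; \<open>qstar_p\<close> shows that the choice does not
  matter, since two lifts differ by a kernel element and the kernel is self-adjoint.\<close>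

definition qstar :: "'a \<Rightarrow> 'a" where
  "qstar a = p (star (SOME x. x \<in> carrier D \<and> p x = a))"

lemma qstar_p:
  assumes x: "x \<in> carrier D"
  shows "qstar (p x) = p (star x)"
proof -
  define y where "y = (SOME y. y \<in> carrier D \<and> p y = p x)"
  have y: "y \<in> carrier D" "p y = p x"
    using someI[of "\<lambda>y. y \<in> carrier D \<and> p y = p x" x] x by (auto simp: y_def)
  have "p (y \<ominus>\<^bsub>D\<^esub> x) = \<zero>\<^bsub>A\<^esub>"
    using x y by (simp add: p.diff p.closed A.normed.diff_eq_zero_iff[THEN iffD2])
  then have "p (star y) \<ominus>\<^bsub>A\<^esub> p (star x) = \<zero>\<^bsub>A\<^esub>"
    using kernel_star[of "y \<ominus>\<^bsub>D\<^esub> x"] x y by (simp add: D.star_diff p.diff D.star_closed)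
  then show ?thesis
    using x y by (simp add: qstar_def y_def[symmetric] A.normed.diff_eq_zero_iff p.closed D.star_closed)
qed

text \<open>The substantial half of the C*-identity. A lift z of the image of x* x differs from x* x
  by a kernel element j. As (1 - u) x is again a lift of \<open>p x\<close>, the square is at most
  the norm of (1 - u)^2 (j + z), hence at most that of (1 - u) j plus that of z, and the first
  summand is as small as desired.\<close>

lemma qnrm_square_le:
  assumes x: "x \<in> carrier D"
  shows "(qnrm (p x))\<^sup>2 \<le> qnrm (p (star x \<otimes>\<^bsub>D\<^esub> x))"
proof (rule le_qnrm)
  have xx: "star x \<otimes>\<^bsub>D\<^esub> x \<in> carrier D"
    using x by (simp add: D.star_closed D.mult_closed)
  then show "p (star x \<otimes>\<^bsub>D\<^esub> x) \<in> carrier A"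
    by (rule p.closed)
  fix z assume z: "z \<in> carrier D" "p z = p (star x \<otimes>\<^bsub>D\<^esub> x)"
  show "(qnrm (p x))\<^sup>2 \<le> nrm D z"
  proof (rule field_le_epsilon)
    fix \<epsilon> :: real assume "\<epsilon> > 0"
    define j where "j = star x \<otimes>\<^bsub>D\<^esub> x \<ominus>\<^bsub>D\<^esub> z"
    have j: "j \<in> carrier D" "p j = \<zero>\<^bsub>A\<^esub>"
      using xx z by (simp_all add: j_def p.diff p.closed A.normed.diff_eq_zero_iff[THEN iffD2])
    obtain u v where u: "u \<in> carrier D" "v \<in> carrier D" "u = v \<otimes>\<^bsub>D\<^esub> j" "star u = u"
      and contr: "\<And>x. x \<in> carrier D \<Longrightarrow> nrm D (x \<ominus>\<^bsub>D\<^esub> u \<otimes>\<^bsub>D\<^esub> x) \<le> nrm D x"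
      and small: "nrm D (j \<ominus>\<^bsub>D\<^esub> u \<otimes>\<^bsub>D\<^esub> j) < \<epsilon>"
      by (fact D.approximate_unit[OF j(1) \<open>\<epsilon> > 0\<close>])
    define V where "V y = y \<ominus>\<^bsub>D\<^esub> u \<otimes>\<^bsub>D\<^esub> y" for y
    have V_closed: "V y \<in> carrier D" if "y \<in> carrier D" for y
      using that u(1) by (simp add: V_def D.mult_closed)
    have V_mult: "V y \<otimes>\<^bsub>D\<^esub> z = V (y \<otimes>\<^bsub>D\<^esub> z)" "y \<otimes>\<^bsub>D\<^esub> V z = V (y \<otimes>\<^bsub>D\<^esub> z)"
      if "y \<in> carrier D" "z \<in> carrier D" for y z
      using that u(1) by (simp_all add: V_def D.mult_diff_distrib_left D.mult_diff_distrib_right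
          D.mult_closed D.mult_assoc D.mult_lcomm)
    have star_V: "star (V x) = V (star x)"
      using x u(1,4) by (simp add: V_def D.star_diff D.star_mult D.mult_closed D.mult_commute D.star_closed)
    have V_add: "V (y \<oplus>\<^bsub>D\<^esub> z) = V y \<oplus>\<^bsub>D\<^esub> V z" if "y \<in> carrier D" "z \<in> carrier D" for y z
    proof -
      have "u \<otimes>\<^bsub>D\<^esub> y \<in> carrier D" "u \<otimes>\<^bsub>D\<^esub> z \<in> carrier D"
        using that u(1) by (simp_all add: D.mult_closed)
      then have "y \<oplus>\<^bsub>D\<^esub> z \<ominus>\<^bsub>D\<^esub> (u \<otimes>\<^bsub>D\<^esub> y \<oplus>\<^bsub>D\<^esub> u \<otimes>\<^bsub>D\<^esub> z) =
          (y \<ominus>\<^bsub>D\<^esub> u \<otimes>\<^bsub>D\<^esub> y) \<oplus>\<^bsub>D\<^esub> (z \<ominus>\<^bsub>D\<^esub> u \<otimes>\<^bsub>D\<^esub> z)"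
        using that by algebra
      then show ?thesis
        using that u(1) by (simp add: V_def D.mult_distr_right)
    qed
    have V_le: "nrm D (V y) \<le> nrm D y" if "y \<in> carrier D" for y
      using contr[OF that] by (simp add: V_def)
    have "qnrm (p x) = qnrm (p (V x))"
      using p_mult_kernel[OF j u(2,3) x] by (simp add: V_def)
    also have "\<dots> \<le> nrm D (V x)"
      by (rule qnrm_le[OF V_closed[OF x]])
    finally have "(qnrm (p x))\<^sup>2 \<le> (nrm D (V x))\<^sup>2"
      by (intro power_mono qnrm_nonneg p.closed[OF x])
    also have "\<dots> = nrm D (star (V x) \<otimes>\<^bsub>D\<^esub> V x)"
      using D.cstar_identity[OF V_closed[OF x]] by simp
    also have "star (V x) \<otimes>\<^bsub>D\<^esub> V x = V (V (star x \<otimes>\<^bsub>D\<^esub> x))"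
      using x by (simp add: star_V V_mult V_closed D.star_closed)
    also have "star x \<otimes>\<^bsub>D\<^esub> x = j \<oplus>\<^bsub>D\<^esub> z"
      using xx z by (simp add: j_def D.normed.diff_add_cancel)
    also have "V (V (j \<oplus>\<^bsub>D\<^esub> z)) = V (V j) \<oplus>\<^bsub>D\<^esub> V (V z)"
      using j z by (simp add: V_add V_closed)
    also have "nrm D \<dots> \<le> nrm D (V (V j)) + nrm D (V (V z))"
      using j z by (intro D.nrm_triangle V_closed)
    also have "\<dots> \<le> nrm D (V j) + nrm D z"
      using j z by (intro add_mono V_le V_closed order.trans[OF V_le V_le])
    also have "\<dots> \<le> nrm D z + \<epsilon>"
      using small by (simp add: V_def)
    finally show "(qnrm (p x))\<^sup>2 \<le> nrm D z + \<epsilon>" .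
  qed
qed

section \<open>The quotient C*-algebra on the carrier of \<open>A\<close>\<close>

lemma p_surj:
  assumes "a \<in> carrier A"
  obtains x where "x \<in> carrier D" "a = p x"
  using p_lift[OF assms] by blast

text \<open>Only the norm of \<open>A\<close> is exchanged, so the identity map will serve as the
  isomorphism.\<close>

definition Q :: "'a normed_alg" where
  "Q = A\<lparr>nrm := qnrm\<rparr>"

lemma Q_simps [simp]:
  "carrier Q = carrier A" "mult Q = mult A" "zero Q = zero A" "add Q = add A" "smult Q = smult A"
  "nrm Q = qnrm" "a_minus Q = a_minus A"
  by (simp_all add: Q_def a_minus_def[abs_def] a_inv_def)

lemma module_Q: "module complex_ring Q"
proof -
  have "abelian_group Q"
    using A.M.abelian_group_axioms
    by (simp add: abelian_group_def abelian_group_axioms_def abelian_monoid_def Q_def)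
  then show ?thesis
    using A.module_axioms by (simp add: module_def module_axioms_def)
qed

lemma normed_module_Q: "normed_module Q"
  by (intro normed_module.intro normed_module_axioms.intro module_Q)
    (simp_all add: qnrm_nonneg qnrm_eq_zero_iff qnrm_triangle qnrm_smult)

text \<open>Completeness passes between equivalent norms: \<open>C\<close> turns Cauchy sequences
  for \<open>qnrm\<close> into Cauchy sequences of \<open>A\<close>, and \<open>M\<close> carries
  the convergence back.\<close>

lemma complete_Q: "Metric_space.mcomplete (carrier Q) (norm_dist Q)"
  unfolding normed_module.mcomplete_iff[OF normed_module_Q]
proof (intro allI impI, elim conjE, unfold Q_simps)
  fix \<sigma> :: "nat \<Rightarrow> 'a"
  assume \<sigma>: "\<forall>n. \<sigma> n \<in> carrier A"
    and cauchy: "\<forall>\<epsilon>>0. \<exists>N. \<forall>m\<ge>N. \<forall>n\<ge>N. qnrm (\<sigma> m \<ominus>\<^bsub>A\<^esub> \<sigma> n) < \<epsilon>"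
  have cauchy': "\<exists>N. \<forall>m\<ge>N. \<forall>n\<ge>N. nrm A (\<sigma> m \<ominus>\<^bsub>A\<^esub> \<sigma> n) < \<epsilon>" if "\<epsilon> > 0" for \<epsilon>
  proof -
    have "\<epsilon> / C > 0"
      using that C_pos by simp
    then obtain N where N: "\<And>m n. \<lbrakk>m \<ge> N; n \<ge> N\<rbrakk> \<Longrightarrow> qnrm (\<sigma> m \<ominus>\<^bsub>A\<^esub> \<sigma> n) < \<epsilon> / C"
      using cauchy by blast
    have "nrm A (\<sigma> m \<ominus>\<^bsub>A\<^esub> \<sigma> n) < \<epsilon>" if "m \<ge> N" "n \<ge> N" for m n
    proof -
      have "C * qnrm (\<sigma> m \<ominus>\<^bsub>A\<^esub> \<sigma> n) < \<epsilon>"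
        using N[OF that] C_pos by (simp add: pos_less_divide_eq mult.commute)
      then show ?thesis
        using nrm_le_qnrm[of "\<sigma> m \<ominus>\<^bsub>A\<^esub> \<sigma> n"] \<sigma> by simp
    qed
    then show ?thesis
      by blast
  qed
  have "\<exists>l\<in>carrier A. \<forall>\<epsilon>>0. \<exists>N. \<forall>n\<ge>N. nrm A (\<sigma> n \<ominus>\<^bsub>A\<^esub> l) < \<epsilon>"
    by (rule A.complete[unfolded A.normed.mcomplete_iff, THEN spec, THEN mp])
      (intro conjI \<sigma> allI impI cauchy')
  then obtain l where l: "l \<in> carrier A"
    and lim: "\<And>\<epsilon>. \<epsilon> > 0 \<Longrightarrow> \<exists>N. \<forall>n\<ge>N. nrm A (\<sigma> n \<ominus>\<^bsub>A\<^esub> l) < \<epsilon>"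
    by auto
  have "\<exists>N. \<forall>n\<ge>N. qnrm (\<sigma> n \<ominus>\<^bsub>A\<^esub> l) < \<epsilon>" if "\<epsilon> > 0" for \<epsilon>
  proof -
    have pos: "\<epsilon> / (\<bar>M\<bar> + 1) > 0"
      using that by simp
    obtain N where N: "\<And>n. n \<ge> N \<Longrightarrow> nrm A (\<sigma> n \<ominus>\<^bsub>A\<^esub> l) < \<epsilon> / (\<bar>M\<bar> + 1)"
      using lim[OF pos] by blast
    have "qnrm (\<sigma> n \<ominus>\<^bsub>A\<^esub> l) < \<epsilon>" if "n \<ge> N" for n
    proof -
      have "qnrm (\<sigma> n \<ominus>\<^bsub>A\<^esub> l) \<le> M * nrm A (\<sigma> n \<ominus>\<^bsub>A\<^esub> l)"
        using \<sigma> l by (intro qnrm_le_nrm) simp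
      also have "\<dots> \<le> (\<bar>M\<bar> + 1) * nrm A (\<sigma> n \<ominus>\<^bsub>A\<^esub> l)"
        using \<sigma> l by (intro mult_right_mono A.nrm_nonneg) auto
      also have "\<dots> < \<epsilon>"
        using N[OF that] by (simp add: pos_less_divide_eq mult.commute add_nonneg_pos)
      finally show ?thesis .
    qed
    then show ?thesis
      by blast
  qed
  then show "\<exists>l\<in>carrier A. \<forall>\<epsilon>>0. \<exists>N. \<forall>n\<ge>N. qnrm (\<sigma> n \<ominus>\<^bsub>A\<^esub> l) < \<epsilon>"
    using l by blast
qed

lemma banach_algebra_Q: "banach_algebra Q"
  by (intro banach_algebra.intro banach_algebra_axioms.intro module_Q complete_Q)
    (simp_all add: qnrm_nonneg qnrm_eq_zero_iff qnrm_triangle qnrm_smult qnrm_mult A.mult_closed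
      A.mult_assoc A.mult_distr_left A.mult_distr_right A.smult_mult_left A.smult_mult_right)

text \<open>\<open>star\<close> takes lifts of \<open>a\<close> to lifts of \<open>qstar a\<close>
  without changing their norms.\<close>

lemma qnrm_qstar_le:
  assumes a: "a \<in> carrier A"
  shows "qnrm (qstar a) \<le> qnrm a"
proof (rule le_qnrm[OF a])
  fix x assume "x \<in> carrier D" "p x = a"
  then show "qnrm (qstar a) \<le> nrm D x"
    using qnrm_le[of "star x"] by (auto simp: qstar_p D.star_closed D.nrm_star)
qed

lemma cstar_algebra_Q: "cstar_algebra Q qstar"
proof (intro cstar_algebra.intro cstar_algebra_axioms.intro banach_algebra_Q, unfold Q_simps)
  fix a c assume a: "a \<in> carrier A"
  obtain x where x: "x \<in> carrier D" "a = p x"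
    using a by (rule p_surj)
  show closed: "qstar a \<in> carrier A"
    using x by (simp add: qstar_p p.closed D.star_closed)
  show "qstar (qstar a) = a"
    using x by (simp add: qstar_p D.star_closed D.star_star)
  show "qstar (c \<odot>\<^bsub>A\<^esub> a) = cnj c \<odot>\<^bsub>A\<^esub> qstar a"
    using x qstar_p[of "c \<odot>\<^bsub>D\<^esub> x"] by (simp add: qstar_p p.scale D.star_smult D.star_closed)
  show "qnrm (qstar a \<otimes>\<^bsub>A\<^esub> a) = (qnrm a)\<^sup>2"
  proof (rule antisym)
    have "qnrm (qstar a \<otimes>\<^bsub>A\<^esub> a) \<le> qnrm (qstar a) * qnrm a"
      by (rule qnrm_mult[OF closed a])
    also have "\<dots> \<le> qnrm a * qnrm a"
      using a by (intro mult_right_mono qnrm_qstar_le qnrm_nonneg)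
    finally show "qnrm (qstar a \<otimes>\<^bsub>A\<^esub> a) \<le> (qnrm a)\<^sup>2"
      by (simp add: power2_eq_square)
    show "(qnrm a)\<^sup>2 \<le> qnrm (qstar a \<otimes>\<^bsub>A\<^esub> a)"
      using qnrm_square_le[OF x(1)] x by (simp add: qstar_p p_mult D.star_closed)
  qed
  fix b assume b: "b \<in> carrier A"
  obtain y where y: "y \<in> carrier D" "b = p y"
    using b by (rule p_surj)
  show "qstar (a \<oplus>\<^bsub>A\<^esub> b) = qstar a \<oplus>\<^bsub>A\<^esub> qstar b"
    using x y qstar_p[of "x \<oplus>\<^bsub>D\<^esub> y"] by (simp add: qstar_p p.add D.star_add D.star_closed)
  show "qstar (a \<otimes>\<^bsub>A\<^esub> b) = qstar b \<otimes>\<^bsub>A\<^esub> qstar a"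
    using x y qstar_p[of "x \<otimes>\<^bsub>D\<^esub> y"]
    by (simp add: qstar_p p_mult D.star_mult D.star_closed D.mult_closed)
qed

lemma isomorphic_to_cstar_algebra: "isomorphic_to_cstar_algebra A"
proof -
  have "algebra_isomorphism A Q (\<lambda>a. a)"
  proof (rule algebra_isomorphismI)
    show "linear_map A Q (\<lambda>a. a)"
      by (intro linear_map.intro linear_map_axioms.intro normed_module_Q A.normed.normed_module_axioms)
        simp_all
    show "linear_map Q A (\<lambda>a. a)"
      by (intro linear_map.intro linear_map_axioms.intro normed_module_Q A.normed.normed_module_axioms)
        simp_all
    show "nrm Q a \<le> M * nrm A a" if "a \<in> carrier A" for a
      using that by (simp add: qnrm_le_nrm)
    show "nrm A a \<le> C * nrm Q a" if "a \<in> carrier Q" for a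
      using that by (simp add: nrm_le_qnrm)
  qed simp_all
  then show ?thesis
    unfolding isomorphic_to_cstar_algebra_def isomorphic_algebras_def
    using cstar_algebra_Q by blast
qed

end

section \<open>The equivalence, by functoriality one way and evaluation at a point the other\<close>

theorem theorem2p5:
  fixes X :: "'x topology" and A :: "'a normed_alg" and e :: "'i \<Rightarrow> 'a" and F :: "'i filter"
  assumes "locally_compact_space X" and "Hausdorff_space X" and "topspace X \<noteq> {}"
    and "comm_banach_algebra A"
    and "topspace (character_space A) \<noteq> {}"
    and "bounded_approximate_identity A e F"
  shows "isomorphic_to_cstar_algebra (C0 X A) \<longleftrightarrow> isomorphic_to_cstar_algebra A"
proof
  interpret A: comm_banach_algebra A by (rule assms)
  interpret X: C0_of_banach_algebra A X
    by unfold_locales (rule assms)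
  interpret C0: banach_algebra "C0 X A"
    by (rule X.banach_algebra_C0)
  {
    assume "isomorphic_to_cstar_algebra A"
    then obtain B :: "'a normed_alg" and star where B: "cstar_algebra B star"
      and AB: "isomorphic_algebras A B"
      by (auto simp: isomorphic_to_cstar_algebra_def)
    have "banach_algebra B"
      using B by (rule cstar_algebra.axioms)
    then have "isomorphic_algebras (C0 X A) (C0 X B)"
      using A.banach_algebra_axioms AB assms(3) by (intro isomorphic_algebras_C0)
    then show "isomorphic_to_cstar_algebra (C0 X A)"
      using cstar_algebra.cstar_algebra_C0[OF B assms(3)]
      unfolding isomorphic_to_cstar_algebra_def by blast
  next
    assume "isomorphic_to_cstar_algebra (C0 X A)"
    then obtain D :: "('x \<Rightarrow> 'a) normed_alg" and star T where D: "cstar_algebra D star"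
      and T: "algebra_isomorphism (C0 X A) D T"
      by (auto simp: isomorphic_to_cstar_algebra_def isomorphic_algebras_def)
    interpret D: cstar_algebra D star by (rule D)
    obtain S c1 c2 where lin_T: "linear_map (C0 X A) D T" and lin_S: "linear_map D (C0 X A) S"
      and ST: "\<And>f. f \<in> carrier (C0 X A) \<Longrightarrow> S (T f) = f" and TS: "\<And>y. y \<in> carrier D \<Longrightarrow> T (S y) = y"
      and T_mult: "\<And>f g. \<lbrakk>f \<in> carrier (C0 X A); g \<in> carrier (C0 X A)\<rbrakk> \<Longrightarrow>
        T (f \<otimes>\<^bsub>C0 X A\<^esub> g) = T f \<otimes>\<^bsub>D\<^esub> T g"
      and c1: "c1 > 0" "\<And>f. f \<in> carrier (C0 X A) \<Longrightarrow> nrm D (T f) \<le> c1 * nrm (C0 X A) f"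
      and c2: "c2 > 0" "\<And>y. y \<in> carrier D \<Longrightarrow> nrm (C0 X A) (S y) \<le> c2 * nrm D y"
      by (fact algebra_isomorphismE[OF X.C0.normed_module_axioms D.normed.normed_module_axioms T])
    interpret T: linear_map "C0 X A" D T by (rule lin_T)
    interpret S: linear_map D "C0 X A" S by (rule lin_S)
    have S_mult: "S (x \<otimes>\<^bsub>D\<^esub> y) = S x \<otimes>\<^bsub>C0 X A\<^esub> S y" if "x \<in> carrier D" "y \<in> carrier D" for x y
      using ST[of "S x \<otimes>\<^bsub>C0 X A\<^esub> S y"] that by (simp add: T_mult S.closed TS X.C0_mult_closed)
    have comm_C0: "f \<otimes>\<^bsub>C0 X A\<^esub> g = g \<otimes>\<^bsub>C0 X A\<^esub> f"
      if "f \<in> carrier (C0 X A)" "g \<in> carrier (C0 X A)" for f g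
      using that by (intro C0_eqI[of _ X A] X.C0_mult_closed)
        (simp_all add: C0_simps A.mult_commute A.normed.C0_app_closed)
    \<comment> \<open>Commutativity of \<open>A\<close> reaches \<open>D\<close> through the
      isomorphism, which opens the way to the commutative ideal theory.\<close>
    interpret D: comm_cstar_algebra D star
    proof
      fix x y assume "x \<in> carrier D" "y \<in> carrier D"
      then show "x \<otimes>\<^bsub>D\<^esub> y = y \<otimes>\<^bsub>D\<^esub> x"
        using T_mult[of "S x" "S y"] T_mult[of "S y" "S x"] comm_C0[of "S x" "S y"]
        by (simp add: S.closed TS)
    qed
    obtain x0 where x0: "x0 \<in> topspace X"
      using assms(3) by blast
    obtain \<phi> K where \<phi>: "continuous_map X euclideanreal \<phi>" "\<phi> x0 = 1"
        "\<And>x. x \<in> topspace X \<Longrightarrow> \<bar>\<phi> x\<bar> \<le> 1"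
      and K: "compactin X K" "\<And>x. x \<in> topspace X - K \<Longrightarrow> \<phi> x = 0"
      by (fact compactly_supported_bump[OF assms(1,2) x0])
    \<comment> \<open>Evaluation at \<open>x0\<close> is composed with the inverse isomorphism
      \<open>S\<close>. It does not increase norms, so \<open>c2\<close> is the bound;
      \<open>c1\<close> controls the image under \<open>T\<close> of the bump function times
      \<open>a\<close>, whose supremum norm is at most that of \<open>a\<close>.\<close>
    have "cstar_quotient D star A (\<lambda>y. S y x0) c2 c1"
    proof (intro cstar_quotient.intro cstar_quotient_axioms.intro linear_map.intro linear_map_axioms.intro
        D.comm_cstar_algebra_axioms A.banach_algebra_axioms D.normed.normed_module_axioms
        A.normed.normed_module_axioms c2(1))
      fix x y c assume x: "x \<in> carrier D"
      show "S x x0 \<in> carrier A"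
        by (rule A.normed.C0_app_closed[OF S.closed[OF x] x0])
      show "S (c \<odot>\<^bsub>D\<^esub> x) x0 = c \<odot>\<^bsub>A\<^esub> S x x0"
        using x x0 by (simp add: S.scale C0_simps)
      show "nrm A (S x x0) \<le> c2 * nrm D x"
        using A.normed.nrm_app_le_nrm_C0[OF S.closed[OF x] x0] c2(2)[OF x] by linarith
      assume y: "y \<in> carrier D"
      show "S (x \<oplus>\<^bsub>D\<^esub> y) x0 = S x x0 \<oplus>\<^bsub>A\<^esub> S y x0"
        using x y x0 by (simp add: S.add C0_simps)
      show "S (x \<otimes>\<^bsub>D\<^esub> y) x0 = S x x0 \<otimes>\<^bsub>A\<^esub> S y x0"
        using x y x0 by (simp add: S_mult C0_simps)
    next
      fix a assume a: "a \<in> carrier A"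
      let ?f = "\<lambda>x\<in>topspace X. complex_of_real (\<phi> x) \<odot>\<^bsub>A\<^esub> a"
      have f: "?f \<in> carrier (C0 X A)"
        using \<phi> K a by (intro A.normed.bump_mem_C0)
      have "nrm (C0 X A) ?f \<le> nrm A a"
      proof (rule nrm_C0_le[OF assms(3)])
        fix x assume x: "x \<in> topspace X"
        then show "nrm A (?f x) \<le> nrm A a"
          using a mult_right_mono[OF \<phi>(3)[OF x] A.nrm_nonneg[OF a]] by (simp add: A.nrm_smult)
      qed
      then have "c1 * nrm (C0 X A) ?f \<le> c1 * nrm A a"
        using c1(1) by simp
      then have "nrm D (T ?f) \<le> c1 * nrm A a"
        using c1(2)[OF f] by linarith
      moreover have "S (T ?f) x0 = a"
        using a x0 by (simp add: ST[OF f] \<phi>(2))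
      ultimately show "\<exists>y\<in>carrier D. S y x0 = a \<and> nrm D y \<le> c1 * nrm A a"
        using T.closed[OF f] by blast
    qed
    then show "isomorphic_to_cstar_algebra A"
      by (rule cstar_quotient.isomorphic_to_cstar_algebra)
  }
qed

end
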